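(* Let $\Lambda=\mathcal KQ/\langle\rho\rangle$ be a string algebra with associated multi-entry inverse automaton $\mathsf M_\Lambda$. Then $\mathfrak{St}(\Lambda)\cong\mathsf W(\mathsf M_\Lambda)/{\sim}$; that is, the map sending the $\sim$-class of a word $(\mathsf w^l,v,\mathsf w^r)$ over $\mathsf M_\Lambda$ to the string $\mathsf w^l\mathsf w^r$ (to the zero-length string $v$ if $\mathsf w^l$ and $\mathsf w^r$ are both empty) is a well-defined bijection from $\mathsf W(\mathsf M_\Lambda)/{\sim}$ to the set $\mathfrak{St}(\Lambda)$ of all finite and infinite strings.
   Context: $\mathcal K$ is an algebraically closed field. **String algebras.** $Q=(Q_0,Q_1,s,t)$ is a finite quiver; a path $\alpha\beta$ requires $t(\alpha)=s(\beta)$. A string algebra is $\mathcal KQ/\langle\rho\rangle$, $\rho$ a finite set of paths of length $\ge 2$, such that: (I) each vertex is the source of at most two arrows and the target of at most two arrows; (II) for each $\alpha\in Q_1$ there is at most one arrow $\gamma$ such that $\alpha\gamma$ is a path not in $\rho$, and at most one arrow $\gamma'$ such that $\gamma'\alpha$ is a path not in $\rho$; (III) there is a bound on the lengths of paths having no subpath in $\rho$. Fix maps $\varsigma,\varepsilon:Q_1\to\{-1,1\}$ with: (a) $\alpha\ne\beta$, $s(\alpha)=s(\beta)$ imply $\varsigma(\alpha)=-\varsigma(\beta)$; (b) $\alpha\ne\beta$, $t(\alpha)=t(\beta)$ imply $\varepsilon(\alpha)=-\varepsilon(\beta)$; (c) $t(\alpha)=s(\beta)$, $\alpha\beta\notin\rho$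 imply $\varepsilon(\alpha)=-\varsigma(\beta)$. **Strings.** Each arrow $\alpha$ has a formal inverse $\alpha^{-1}$, with $(\alpha^{-1})^{-1}=\alpha$, $s(\alpha^{-1})=t(\alpha)$, $t(\alpha^{-1})=s(\alpha)$, $\varsigma(\alpha^{-1})=\varepsilon(\alpha)$, $\varepsilon(\alpha^{-1})=\varsigma(\alpha)$. Elements of $Q_1\sqcup Q_1^{-1}$ are syllables. A finite string of length $k\ge1$ is a sequence of syllables $\alpha_1\cdots\alpha_k$ with $t(\alpha_i)=s(\alpha_{i+1})$, $\alpha_i\ne\alpha_{i+1}^{-1}$, and neither $\alpha_i\cdots\alpha_{i+j}$ nor $\alpha_{i+j}^{-1}\cdots\alpha_i^{-1}$ in $\rho$ for all $1\le i\le i+j\le k$. For each $v\in Q_0$ there are also two zero-length strings $1_{(v,1)},1_{(v,-1)}$ with source and target $v$, $1_{(v,i)}^{-1}=1_{(v,-i)}$, $\varsigma(1_{(v,i)})=-i$, $\varepsilon(1_{(v,i)})=i$. Set $\varsigma(\alpha_1\cdots\alpha_k)=\varsigma(\alpha_1)$, $\varepsilon(\alpha_1\cdots\alpha_k)=\varepsilon(\alpha_k)$, and similarly for source and target. $\mathfrak x1_{(v,i)}$ is defined (and equals $\mathfrak x$) iff $t(\mathfrak x)=v,\varepsilon(\mathfrak x)=i$; $1_{(v,i)}\mathfrak x$ is defined (and equals $\mathfrak x$) iff $s(\mathfrak x)=v,\varsigma(\mathfrak x)=-i$. Infinite strings are sequences of syllables indexed by $\mathbb N$ ($\alpha_1\alpha_2\cdots$),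 by $\mathbb N^{op}$ ($\cdots\alpha_2\alpha_1$), or by $\mathbb Z$ (the last taken up to shift of the index), all of whose finite consecutive subsequences are strings. $\mathfrak{St}(\Lambda)$ is the set of all finite and infinite strings. A left (right) substring is an initial (final) part, written $\sqsubseteq_l$ ($\sqsubseteq_r$). The same notation is used for words over an alphabet. **Multi-entry inverse automaton (MIA).** A tuple $\mathsf M=(\mathsf M_0,\mathsf I,\mathsf e,(-)^{-1},\mathsf A,\mathsf t)$ with $\mathsf M_0$ a finite set of states, $\mathsf I\subseteq\mathsf M_0$ the initial states, $\mathsf e:\mathsf M_0\to\mathsf I$, $(-)^{-1}:\mathsf I\to\mathsf I$, $\mathsf A$ a finite alphabet with $\mathsf A^\pm=\mathsf A\sqcup\mathsf A^{-1}$ (formal inverses), and a partial function $\mathsf t:\mathsf M_0\times\mathsf A^\pm\rightharpoonup\mathsf M_0$ such that: (1) $(-)^{-1}$ is an involution without fixed points; (2) $\mathsf e(v)=v$ for $v\in\mathsf I$; (3) if $\mathsf t(v,\mathsf b)$ is defined then $\mathsf t(\mathsf e(v),\mathsf b)$ is defined and $\mathsf e(\mathsf t(v,\mathsf b))=\mathsf e(\mathsf t(\mathsf e(v),\mathsf b))$. $\widetilde{\mathsf t}$ is the extension of $\mathsf t$ to finite words: $\widetilde{\mathsf t}(v,\epsilon)=v$ for the empty word $\epsilon$, $\widetilde{\mathsf t}(v,\mathsf w'\mathsf b)=\mathsf t(\widetilde{\mathsf t}(v,\mathsf w'),\mathsf b)$. **Words over an MIA.** Words are finite, right-infinite, left-infinite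 or bi-infinite sequences over $\mathsf A^\pm$; the inverse of a word reverses the order and inverts each letter. A right word is $(v,\mathsf w)$ with $v\in\mathsf I$ and $\mathsf w$ finite or right-infinite such that $\widetilde{\mathsf t}(v,\mathsf w')$ is defined for all finite $\mathsf w'\sqsubseteq_l\mathsf w$. A left word is $(\mathsf w,v)$ such that $(v^{-1},\mathsf w^{-1})$ is a right word. A word over $\mathsf M$ is a triple $(\mathsf w^l,v,\mathsf w^r)$ with $v\in\mathsf I$, $(\mathsf w^l,v)$ a left word, $(v,\mathsf w^r)$ a right word, and $(\mathsf w^l\mathsf w',\mathsf e(\widetilde{\mathsf t}(v,\mathsf w')))$ a left word for each finite $\mathsf w'\sqsubseteq_l\mathsf w^r$. $\mathsf W(\mathsf M)$ is the set of words over $\mathsf M$. The relation $\sim$ on $\mathsf W(\mathsf M)$ is the symmetric closure of: $(\mathsf w_1^l,v_1,\mathsf w_1^r)\sim(\mathsf w_2^l,v_2,\mathsf w_2^r)$ if there is a finite word $\overline{\mathsf w}$ with $\mathsf w_1^l=\mathsf w_2^l\overline{\mathsf w}$, $\mathsf w_2^r=\overline{\mathsf w}\mathsf w_1^r$ and $\mathsf e(\widetilde{\mathsf t}(v_2,\overline{\mathsf w}))=v_1$. **The MIA $\mathsf M_\Lambda$.** Its alphabet is $Q_1$; its initial states are the zero-length strings, with $(-)^{-1}$ given by $1_{(v,i)}^{-1}=1_{(v,-i)}$; its states are the zero-length strings, all syllables in $Q_1\sqcup Q_1^{-1}$, and all strings $\mathfrak y$ that are proper left substrings of some $\mathfrak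 r$ with $\mathfrak r\in\rho$ or $\mathfrak r^{-1}\in\rho$; $\mathsf t_\Lambda(\mathfrak x,\mathsf b)$ is defined iff $\mathfrak x\mathsf b\in\mathfrak{St}(\Lambda)$, and then it is the maximal right substring of $\mathfrak x\mathsf b$ that is a state; $\mathsf e_\Lambda(\mathfrak x)=1_{(t(\mathfrak x),\varepsilon(\mathfrak x))}$. *)

theory Defs
  imports
    "HOL-Algebra.Algebraic_Closure"
    "Graph_Theory.Arc_Walk"
    "HOL-Library.Sublist"
    "HOL-Library.Stream"
begin

section \<open>Letters and words\<close>

text \<open>
  \<open>Pos a\<close> is the letter \<open>a\<close> and \<open>Neg a\<close> its formal inverse.  Over the arrows of a quiver,
  letters are what one calls syllables.
\<close>

datatype 'a letter = Pos 'a | Neg 'a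

fun letter_inv :: "'a letter \<Rightarrow> 'a letter" where
  "letter_inv (Pos a) = Neg a"
| "letter_inv (Neg a) = Pos a"

definition letters :: "'a set \<Rightarrow> 'a letter set" where
  "letters A = Pos ` A \<union> Neg ` A"

definition list_inv :: "'a letter list \<Rightarrow> 'a letter list" where
  "list_inv xs = rev (map letter_inv xs)"

text \<open>
  \<open>LeftInf s\<close> is the word indexed by the opposite order of the naturals whose last letter is
  \<open>s !! 0\<close>, whose second to last letter is \<open>s !! 1\<close>, and so on.
  The argument of \<open>BiInf\<close> is meant to be a class \<open>shift_class f\<close>, so that words indexed by
  the integers are taken up to shift of the index.
\<close>

datatype 'l word =
    Finite "'l list"
  | RightInf "'l stream"
  | LeftInf "'l stream"
  | BiInf "(int \<Rightarrow> 'l) set"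

definition shift_class :: "(int \<Rightarrow> 'l) \<Rightarrow> (int \<Rightarrow> 'l) set" where
  "shift_class f = {g. \<exists>k. \<forall>i. g i = f (i + k)}"

fun word_inv :: "'a letter word \<Rightarrow> 'a letter word" where
  "word_inv (Finite xs) = Finite (list_inv xs)"
| "word_inv (RightInf s) = LeftInf (smap letter_inv s)"
| "word_inv (LeftInf s) = RightInf (smap letter_inv s)"
| "word_inv (BiInf S) = BiInf ((\<lambda>f i. letter_inv (f (- i))) ` S)"

definition bi_join :: "'l stream \<Rightarrow> 'l stream \<Rightarrow> int \<Rightarrow> 'l" where
  "bi_join l r = (\<lambda>i. if i \<ge> 0 then r !! nat i else l !! nat (- i - 1))"

text \<open>
  Concatenation is meaningful only if the left factor does not extend infinitely to the right
  and the right factor does not extend infinitely to the left.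
\<close>

fun word_append :: "'l word \<Rightarrow> 'l word \<Rightarrow> 'l word" where
  "word_append (Finite xs) (Finite ys) = Finite (xs @ ys)"
| "word_append (Finite xs) (RightInf s) = RightInf (xs @- s)"
| "word_append (LeftInf s) (Finite ys) = LeftInf (rev ys @- s)"
| "word_append (LeftInf l) (RightInf r) = BiInf (shift_class (bi_join l r))"
| "word_append _ _ = undefined"

fun finite_prefix :: "'l list \<Rightarrow> 'l word \<Rightarrow> bool" where
  "finite_prefix u (Finite xs) \<longleftrightarrow> prefix u xs"
| "finite_prefix u (RightInf s) \<longleftrightarrow> (\<exists>n. u = stake n s)"
| "finite_prefix u _ \<longleftrightarrow> False"

text \<open>All finite consecutive subsequences, including the empty one.\<close>

fun finite_factors :: "'l word \<Rightarrow> 'l list set" where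
  "finite_factors (Finite xs) = {u. sublist u xs}"
| "finite_factors (RightInf s) = {stake n (sdrop m s) |m n. True}"
| "finite_factors (LeftInf s) = {rev (stake n (sdrop m s)) |m n. True}"
| "finite_factors (BiInf S) = {map f [i..j] |f i j. f \<in> S}"


section \<open>String algebras\<close>

text \<open>
  The algebra is given by its presentation: ground field \<open>K\<close>, quiver \<open>Q\<close>, relations \<open>\<rho>\<close>.
  A path is the list of its arrows in the order of traversal, so that \<open>[\<alpha>, \<beta>]\<close> is a path
  iff the head of \<open>\<alpha>\<close> is the tail of \<open>\<beta>\<close>.
\<close>

locale string_algebra = algebraically_closed K + fin_digraph Q
  for K :: "'k ring" and Q :: "('v, 'a) pre_digraph" +
  fixes \<rho> :: "'a list set"
  assumes finite_rels: "finite \<rho>"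
    and rels_paths: "p \<in> \<rho> \<Longrightarrow> (\<exists>u v. awalk u p v) \<and> length p \<ge> 2"
    and at_most_two_out: "v \<in> verts Q \<Longrightarrow> card {\<alpha> \<in> arcs Q. tail Q \<alpha> = v} \<le> 2"
    and at_most_two_in: "v \<in> verts Q \<Longrightarrow> card {\<alpha> \<in> arcs Q. head Q \<alpha> = v} \<le> 2"
    and at_most_one_after:
      "\<alpha> \<in> arcs Q \<Longrightarrow> card {\<gamma> \<in> arcs Q. head Q \<alpha> = tail Q \<gamma> \<and> [\<alpha>, \<gamma>] \<notin> \<rho>} \<le> 1"
    and at_most_one_before:
      "\<alpha> \<in> arcs Q \<Longrightarrow> card {\<gamma> \<in> arcs Q. head Q \<gamma> = tail Q \<alpha> \<and> [\<gamma>, \<alpha>] \<notin> \<rho>} \<le> 1"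
    and bounded_paths:
      "\<exists>N. \<forall>u p v. awalk u p v \<and> (\<forall>r\<in>\<rho>. \<not> sublist r p) \<longrightarrow> length p \<le> N"

locale sign_maps =
  fixes Q :: "('v, 'a) pre_digraph" and \<rho> :: "'a list set"
    and \<sigma> \<epsilon> :: "'a \<Rightarrow> int"
  assumes sigma_sign: "\<alpha> \<in> arcs Q \<Longrightarrow> \<sigma> \<alpha> \<in> {-1, 1}"
    and epsilon_sign: "\<alpha> \<in> arcs Q \<Longrightarrow> \<epsilon> \<alpha> \<in> {-1, 1}"
    and sigma_differ:
      "\<lbrakk>\<alpha> \<in> arcs Q; \<beta> \<in> arcs Q; \<alpha> \<noteq> \<beta>; tail Q \<alpha> = tail Q \<beta>\<rbrakk> \<Longrightarrow> \<sigma> \<alpha> = - \<sigma> \<beta>"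
    and epsilon_differ:
      "\<lbrakk>\<alpha> \<in> arcs Q; \<beta> \<in> arcs Q; \<alpha> \<noteq> \<beta>; head Q \<alpha> = head Q \<beta>\<rbrakk> \<Longrightarrow> \<epsilon> \<alpha> = - \<epsilon> \<beta>"
    and epsilon_sigma:
      "\<lbrakk>\<alpha> \<in> arcs Q; \<beta> \<in> arcs Q; head Q \<alpha> = tail Q \<beta>; [\<alpha>, \<beta>] \<notin> \<rho>\<rbrakk> \<Longrightarrow> \<epsilon> \<alpha> = - \<sigma> \<beta>"


section \<open>Strings\<close>

fun letter_src :: "('v, 'a) pre_digraph \<Rightarrow> 'a letter \<Rightarrow> 'v" where
  "letter_src Q (Pos a) = tail Q a"
| "letter_src Q (Neg a) = head Q a"

fun letter_tgt :: "('v, 'a) pre_digraph \<Rightarrow> 'a letter \<Rightarrow> 'v" where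
  "letter_tgt Q (Pos a) = head Q a"
| "letter_tgt Q (Neg a) = tail Q a"

fun letter_sigma :: "('a \<Rightarrow> int) \<Rightarrow> ('a \<Rightarrow> int) \<Rightarrow> 'a letter \<Rightarrow> int" where
  "letter_sigma \<sigma> \<epsilon> (Pos a) = \<sigma> a"
| "letter_sigma \<sigma> \<epsilon> (Neg a) = \<epsilon> a"

fun letter_epsilon :: "('a \<Rightarrow> int) \<Rightarrow> ('a \<Rightarrow> int) \<Rightarrow> 'a letter \<Rightarrow> int" where
  "letter_epsilon \<sigma> \<epsilon> (Pos a) = \<epsilon> a"
| "letter_epsilon \<sigma> \<epsilon> (Neg a) = \<sigma> a"

text \<open>\<open>Trivial v i\<close> is the zero-length string with index \<open>(v, i)\<close>.\<close>

datatype ('v, 'a) qstring = Trivial 'v int | Proper "'a letter word"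

fun string_inv :: "('v, 'a) qstring \<Rightarrow> ('v, 'a) qstring" where
  "string_inv (Trivial v i) = Trivial v (- i)"
| "string_inv (Proper w) = Proper (word_inv w)"

text \<open>Target and sign at the end are only used for finite strings.\<close>

fun string_tgt :: "('v, 'a) pre_digraph \<Rightarrow> ('v, 'a) qstring \<Rightarrow> 'v" where
  "string_tgt Q (Trivial v i) = v"
| "string_tgt Q (Proper (Finite xs)) = letter_tgt Q (last xs)"
| "string_tgt Q _ = undefined"

fun string_epsilon :: "('a \<Rightarrow> int) \<Rightarrow> ('a \<Rightarrow> int) \<Rightarrow> ('v, 'a) qstring \<Rightarrow> int" where
  "string_epsilon \<sigma> \<epsilon> (Trivial v i) = i"
| "string_epsilon \<sigma> \<epsilon> (Proper (Finite xs)) = letter_epsilon \<sigma> \<epsilon> (last xs)"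
| "string_epsilon \<sigma> \<epsilon> _ = undefined"

definition trivial_strings :: "('v, 'a) pre_digraph \<Rightarrow> ('v, 'a) qstring set" where
  "trivial_strings Q = {Trivial v i |v i. v \<in> verts Q \<and> i \<in> {-1, 1}}"

definition is_string_list ::
  "('v, 'a) pre_digraph \<Rightarrow> 'a list set \<Rightarrow> 'a letter list \<Rightarrow> bool" where
  "is_string_list Q \<rho> xs \<longleftrightarrow>
     xs \<noteq> [] \<and> set xs \<subseteq> letters (arcs Q) \<and>
     successively (\<lambda>x y. letter_tgt Q x = letter_src Q y \<and> x \<noteq> letter_inv y) xs \<and>
     (\<forall>u. sublist u xs \<longrightarrow> u \<notin> map Pos ` \<rho> \<and> list_inv u \<notin> map Pos ` \<rho>)"

definition is_infinite_string ::
  "('v, 'a) pre_digraph \<Rightarrow> 'a list set \<Rightarrow> 'a letter word \<Rightarrow> bool" where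
  "is_infinite_string Q \<rho> w \<longleftrightarrow>
     ((\<exists>s. w = RightInf s) \<or> (\<exists>s. w = LeftInf s) \<or> (\<exists>f. w = BiInf (shift_class f))) \<and>
     (\<forall>u \<in> finite_factors w. u \<noteq> [] \<longrightarrow> is_string_list Q \<rho> u)"

definition strings ::
  "('v, 'a) pre_digraph \<Rightarrow> 'a list set \<Rightarrow> ('v, 'a) qstring set" where
  "strings Q \<rho> =
     trivial_strings Q \<union>
     {Proper (Finite xs) |xs. is_string_list Q \<rho> xs} \<union>
     {Proper w |w. is_infinite_string Q \<rho> w}"

text \<open>
  The concatenation of a finite string with a single syllable, where defined.  Whether the
  result is again a string is a separate question.
\<close>

fun string_snoc ::
  "('v, 'a) pre_digraph \<Rightarrow> ('a \<Rightarrow> int) \<Rightarrow> ('a \<Rightarrow> int) \<Rightarrow>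
   ('v, 'a) qstring \<Rightarrow> 'a letter \<Rightarrow> ('v, 'a) qstring option" where
  "string_snoc Q \<sigma> \<epsilon> (Trivial v i) b =
     (if letter_src Q b = v \<and> letter_sigma \<sigma> \<epsilon> b = - i then Some (Proper (Finite [b])) else None)"
| "string_snoc Q \<sigma> \<epsilon> (Proper (Finite xs)) b = Some (Proper (Finite (xs @ [b])))"
| "string_snoc Q \<sigma> \<epsilon> _ b = None"

text \<open>
  Right substrings of finite strings: the final parts of positive length, and the one
  zero-length string \<open>1\<close> for which the product \<open>x 1\<close> is defined.
\<close>

definition right_substring ::
  "('v, 'a) pre_digraph \<Rightarrow> ('a \<Rightarrow> int) \<Rightarrow> ('a \<Rightarrow> int) \<Rightarrow>
   ('v, 'a) qstring \<Rightarrow> ('v, 'a) qstring \<Rightarrow> bool" where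
  "right_substring Q \<sigma> \<epsilon> z x \<longleftrightarrow>
     z = Trivial (string_tgt Q x) (string_epsilon \<sigma> \<epsilon> x) \<or>
     (\<exists>us xs. z = Proper (Finite us) \<and> x = Proper (Finite xs) \<and> us \<noteq> [] \<and> suffix us xs)"

fun string_length :: "('v, 'a) qstring \<Rightarrow> nat" where
  "string_length (Trivial v i) = 0"
| "string_length (Proper (Finite xs)) = length xs"
| "string_length _ = undefined"


section \<open>Multi-entry inverse automata\<close>

record ('s, 'b) mia =
  states :: "'s set"
  initial :: "'s set"
  entry :: "'s \<Rightarrow> 's"
  state_inv :: "'s \<Rightarrow> 's"
  alphabet :: "'b set"
  step :: "'s \<Rightarrow> 'b letter \<Rightarrow> 's option"

locale multi_entry_inverse_automaton =
  fixes M :: "('s, 'b) mia"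
  assumes finite_states: "finite (states M)"
    and initial_states: "initial M \<subseteq> states M"
    and entry_initial: "x \<in> states M \<Longrightarrow> entry M x \<in> initial M"
    and inv_initial: "v \<in> initial M \<Longrightarrow> state_inv M v \<in> initial M"
    and finite_alphabet: "finite (alphabet M)"
    and step_dom: "step M x b = Some y \<Longrightarrow> x \<in> states M \<and> b \<in> letters (alphabet M)"
    and step_ran: "step M x b = Some y \<Longrightarrow> y \<in> states M"
    and inv_involution: "v \<in> initial M \<Longrightarrow> state_inv M (state_inv M v) = v"
    and inv_no_fixpoint: "v \<in> initial M \<Longrightarrow> state_inv M v \<noteq> v"
    and entry_fixes_initial: "v \<in> initial M \<Longrightarrow> entry M v = v"
    and step_entry:
      "step M x b = Some y \<Longrightarrow> \<exists>z. step M (entry M x) b = Some z \<and> entry M y = entry M z"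

definition steps :: "('s, 'b) mia \<Rightarrow> 's \<Rightarrow> 'b letter list \<Rightarrow> 's option" where
  "steps M x w = foldl (\<lambda>y b. Option.bind y (\<lambda>z. step M z b)) (Some x) w"

lemma steps_Nil [simp]: "steps M x [] = Some x"
  by (simp add: steps_def)

lemma steps_snoc [simp]:
  "steps M x (w @ [b]) = Option.bind (steps M x w) (\<lambda>z. step M z b)"
  by (simp add: steps_def)

definition right_word :: "('s, 'b) mia \<Rightarrow> 's \<Rightarrow> 'b letter word \<Rightarrow> bool" where
  "right_word M v w \<longleftrightarrow>
     v \<in> initial M \<and> ((\<exists>xs. w = Finite xs) \<or> (\<exists>s. w = RightInf s)) \<and>
     (\<forall>u. finite_prefix u w \<longrightarrow> steps M v u \<noteq> None)"

definition left_word :: "('s, 'b) mia \<Rightarrow> 'b letter word \<Rightarrow> 's \<Rightarrow> bool" where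
  "left_word M w v \<longleftrightarrow> v \<in> initial M \<and> right_word M (state_inv M v) (word_inv w)"

type_synonym ('s, 'b) pointed_word = "'b letter word \<times> 's \<times> 'b letter word"

definition mia_words :: "('s, 'b) mia \<Rightarrow> ('s, 'b) pointed_word set" where
  "mia_words M =
     {(wl, v, wr). v \<in> initial M \<and> left_word M wl v \<and> right_word M v wr \<and>
        (\<forall>u. finite_prefix u wr \<longrightarrow>
           left_word M (word_append wl (Finite u)) (entry M (the (steps M v u))))}"

definition mia_shift :: "('s, 'b) mia \<Rightarrow> ('s, 'b) pointed_word rel" where
  "mia_shift M =
     {((wl1, v1, wr1), (wl2, v2, wr2)).
        (wl1, v1, wr1) \<in> mia_words M \<and> (wl2, v2, wr2) \<in> mia_words M \<and>
        (\<exists>u. wl1 = word_append wl2 (Finite u) \<and> wr2 = word_append (Finite u) wr1 \<and>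
             map_option (entry M) (steps M v2 u) = Some v1)}"

definition mia_sim :: "('s, 'b) mia \<Rightarrow> ('s, 'b) pointed_word rel" where
  "mia_sim M = mia_shift M \<union> (mia_shift M)\<inverse>"


section \<open>The automaton of a string algebra\<close>

text \<open>
  Zero-length left substrings of relations need no separate mention, since all zero-length
  strings are states.
\<close>

definition string_states ::
  "('v, 'a) pre_digraph \<Rightarrow> 'a list set \<Rightarrow> ('v, 'a) qstring set" where
  "string_states Q \<rho> =
     trivial_strings Q \<union>
     {Proper (Finite [b]) |b. b \<in> letters (arcs Q)} \<union>
     {Proper (Finite ys) |ys. is_string_list Q \<rho> ys \<and>
        (\<exists>r. (r \<in> map Pos ` \<rho> \<or> list_inv r \<in> map Pos ` \<rho>) \<and> strict_prefix ys r)}"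

definition string_step ::
  "('v, 'a) pre_digraph \<Rightarrow> 'a list set \<Rightarrow> ('a \<Rightarrow> int) \<Rightarrow> ('a \<Rightarrow> int) \<Rightarrow>
   ('v, 'a) qstring \<Rightarrow> 'a letter \<Rightarrow> ('v, 'a) qstring option" where
  "string_step Q \<rho> \<sigma> \<epsilon> x b =
     (if x \<in> string_states Q \<rho> \<and> b \<in> letters (arcs Q) then
        (case string_snoc Q \<sigma> \<epsilon> x b of
           None \<Rightarrow> None
         | Some y \<Rightarrow>
             if y \<in> strings Q \<rho>
             then Some (ARG_MAX string_length z. z \<in> string_states Q \<rho> \<and> right_substring Q \<sigma> \<epsilon> z y)
             else None)
      else None)"

definition string_mia ::
  "('v, 'a) pre_digraph \<Rightarrow> 'a list set \<Rightarrow> ('a \<Rightarrow> int) \<Rightarrow> ('a \<Rightarrow> int) \<Rightarrow>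
   (('v, 'a) qstring, 'a) mia" where
  "string_mia Q \<rho> \<sigma> \<epsilon> =
     \<lparr>states = string_states Q \<rho>,
      initial = trivial_strings Q,
      entry = (\<lambda>x. Trivial (string_tgt Q x) (string_epsilon \<sigma> \<epsilon> x)),
      state_inv = string_inv,
      alphabet = arcs Q,
      step = string_step Q \<rho> \<sigma> \<epsilon>\<rparr>"

fun word_to_string :: "(('v, 'a) qstring, 'a) pointed_word \<Rightarrow> ('v, 'a) qstring" where
  "word_to_string (wl, v, wr) =
     (if wl = Finite [] \<and> wr = Finite [] then v else Proper (word_append wl wr))"


section \<open>The automaton satisfies the axioms\<close>

lemma string_stepE:
  assumes "string_step Q \<rho> \<sigma> \<epsilon> x b = Some y"
  obtains us where "y = Proper (Finite us)" "us \<noteq> []" "last us = b" "y \<in> string_states Q \<rho>"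
    "x \<in> string_states Q \<rho>" "b \<in> letters (arcs Q)"
proof -
  from assms obtain w where w: "x \<in> string_states Q \<rho>" "b \<in> letters (arcs Q)"
    "string_snoc Q \<sigma> \<epsilon> x b = Some w"
    and y: "y = (ARG_MAX string_length z. z \<in> string_states Q \<rho> \<and> right_substring Q \<sigma> \<epsilon> z w)"
    by (auto simp: string_step_def split: if_splits option.splits)
  obtain xs where xs: "w = Proper (Finite (xs @ [b]))"
  proof (cases x)
    case (Trivial v i)
    then show thesis using that[of "[]"] w(3) by (simp split: if_splits)
  next
    case (Proper u)
    then show thesis using that w(3) by (cases u) auto
  qed
  let ?P = "\<lambda>z. z \<in> string_states Q \<rho> \<and> right_substring Q \<sigma> \<epsilon> z w"
  have Pb: "?P (Proper (Finite [b]))"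
    using w(2) xs by (auto simp: string_states_def right_substring_def)
  have "string_length z < Suc (length xs + 1)" if "right_substring Q \<sigma> \<epsilon> z w" for z
  proof -
    from that consider "string_length z = 0" | us where "z = Proper (Finite us)" "suffix us (xs @ [b])"
      unfolding right_substring_def xs by auto
    then show ?thesis
    proof cases
      case (2 us)
      then show ?thesis using suffix_length_le[of us "xs @ [b]"] by simp
    qed simp
  qed
  then have "\<forall>z. ?P z \<longrightarrow> string_length z < Suc (length xs + 1)" by blast
  from arg_max_nat_lemma[of ?P, OF Pb this]
  have P: "?P y" and max: "\<forall>z. ?P z \<longrightarrow> string_length z \<le> string_length y"
    unfolding y by blast+
  have "1 \<le> string_length y"
    using max[rule_format, OF Pb] by simp
  with P obtain us where us: "y = Proper (Finite us)" "us \<noteq> []" "suffix us (xs @ [b])"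
    unfolding right_substring_def xs by auto
  then have "last us = b"
    unfolding suffix_def by (metis last_appendR last_snoc)
  then show thesis
    using that[OF us(1,2)] P w(1,2) by blast
qed

lemma epsilon_sign_letter:
  assumes "sign_maps Q \<rho> \<sigma> \<epsilon>" "b \<in> letters (arcs Q)"
  shows "letter_epsilon \<sigma> \<epsilon> b \<in> {-1, 1}"
  using assms by (auto simp: letters_def dest: sign_maps.sigma_sign sign_maps.epsilon_sign)

lemma epsilon_sigma_letter:
  assumes "sign_maps Q \<rho> \<sigma> \<epsilon>" "is_string_list Q \<rho> (xs @ [a, b])"
  shows "letter_epsilon \<sigma> \<epsilon> a = - letter_sigma \<sigma> \<epsilon> b"
proof -
  interpret sign_maps Q \<rho> \<sigma> \<epsilon> by fact
  have "sublist [a, b] (xs @ [a, b])"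
    by (auto simp: sublist_def)
  with assms(2) have rel: "[a, b] \<notin> map Pos ` \<rho>" "list_inv [a, b] \<notin> map Pos ` \<rho>"
    and ab: "a \<in> letters (arcs Q)" "b \<in> letters (arcs Q)"
      "letter_tgt Q a = letter_src Q b" "a \<noteq> letter_inv b"
    by (auto simp: is_string_list_def successively_append_iff)
  show ?thesis
  proof (cases a; cases b)
    fix c d assume c: "a = Pos c" "b = Pos d"
    have "[c, d] \<notin> \<rho>"
    proof
      assume "[c, d] \<in> \<rho>"
      from imageI[OF this, of "map Pos"] show False using rel c by simp
    qed
    then show ?thesis using c ab epsilon_sigma[of c d] by (auto simp: letters_def)
  next
    fix c d assume c: "a = Neg c" "b = Neg d"
    have "[d, c] \<notin> \<rho>"
    proof
      assume "[d, c] \<in> \<rho>"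
      from imageI[OF this, of "map Pos"] show False using rel c by (simp add: list_inv_def)
    qed
    then show ?thesis using c ab epsilon_sigma[of d c] by (auto simp: letters_def)
  next
    fix c d assume c: "a = Pos c" "b = Neg d"
    then show ?thesis using ab epsilon_differ[of c d] by (auto simp: letters_def)
  next
    fix c d assume c: "a = Neg c" "b = Pos d"
    then show ?thesis using ab sigma_differ[of c d] by (auto simp: letters_def)
  qed
qed

lemma is_string_list_single:
  assumes "string_algebra K Q \<rho>" "b \<in> letters (arcs Q)"
  shows "is_string_list Q \<rho> [b]"
proof -
  interpret string_algebra K Q \<rho> by fact
  have long: "2 \<le> length u" if "u \<in> map Pos ` \<rho>" for u
    using that rels_paths by auto
  have "u \<notin> map Pos ` \<rho> \<and> list_inv u \<notin> map Pos ` \<rho>" if "sublist u [b]" for u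
    using sublist_length_le[OF that] long[of u] long[of "list_inv u"]
    by (auto simp: list_inv_def)
  then show ?thesis
    using assms(2) unfolding is_string_list_def by simp
qed

lemma letter_inv_inv [simp]: "letter_inv (letter_inv x) = x"
  by (cases x) auto

lemma list_inv_inv [simp]: "list_inv (list_inv r) = r"
  by (simp add: list_inv_def rev_map o_def)

lemma finite_string_states:
  fixes Q :: "('v, 'a) pre_digraph"
  assumes "string_algebra K Q \<rho>"
  shows "finite (string_states Q \<rho>)"
proof -
  interpret string_algebra K Q \<rho> by fact
  have "{ys. \<exists>r. (r \<in> map Pos ` \<rho> \<or> list_inv r \<in> map Pos ` \<rho>) \<and> strict_prefix ys r}
      \<subseteq> (\<Union>r \<in> map Pos ` \<rho> \<union> list_inv ` map Pos ` \<rho>. set (prefixes r))"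
  proof
    fix ys assume "ys \<in> {ys. \<exists>r. (r \<in> map Pos ` \<rho> \<or> list_inv r \<in> map Pos ` \<rho>) \<and> strict_prefix ys r}"
    then obtain r where r: "r \<in> map Pos ` \<rho> \<or> list_inv r \<in> map Pos ` \<rho>" "strict_prefix ys r"
      unfolding mem_Collect_eq by iprover
    have "r \<in> list_inv ` map Pos ` \<rho>" if "list_inv r \<in> map Pos ` \<rho>"
      using imageI[OF that, of list_inv] by simp
    with r(1) have "r \<in> map Pos ` \<rho> \<union> list_inv ` map Pos ` \<rho>"
      unfolding Un_iff by iprover
    moreover have "ys \<in> set (prefixes r)"
      using r(2) unfolding in_set_prefixes by (rule prefix_order.less_imp_le)
    ultimately show "ys \<in> (\<Union>r \<in> map Pos ` \<rho> \<union> list_inv ` map Pos ` \<rho>. set (prefixes r))"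
      by (rule UN_I)
  qed
  then have "finite {ys. \<exists>r. (r \<in> map Pos ` \<rho> \<or> list_inv r \<in> map Pos ` \<rho>) \<and> strict_prefix ys r}"
    by (rule finite_subset) (use finite_rels in auto)
  then have "finite ((\<lambda>ys. Proper (Finite ys)) `
      {ys. \<exists>r. (r \<in> map Pos ` \<rho> \<or> list_inv r \<in> map Pos ` \<rho>) \<and> strict_prefix ys r} :: ('v, 'a) qstring set)"
    by (rule finite_imageI)
  then have "finite ({Proper (Finite ys) |ys. is_string_list Q \<rho> ys \<and>
        (\<exists>r. (r \<in> map Pos ` \<rho> \<or> list_inv r \<in> map Pos ` \<rho>) \<and> strict_prefix ys r)} :: ('v, 'a) qstring set)"
    by (rule finite_subset[rotated]) auto
  moreover have "finite (trivial_strings Q)"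
  proof -
    have "trivial_strings Q = (\<lambda>(v, i). Trivial v i) ` (verts Q \<times> {-1, 1})"
      by (auto simp: trivial_strings_def)
    then show ?thesis by simp
  qed
  moreover have "finite ({Proper (Finite [b]) |b. b \<in> letters (arcs Q)} :: ('v, 'a) qstring set)"
  proof -
    have "finite (letters (arcs Q))" by (simp add: letters_def)
    then show ?thesis by (simp add: setcompr_eq_image)
  qed
  ultimately show ?thesis by (simp add: string_states_def)
qed

lemma string_states_cases:
  assumes "string_algebra K Q \<rho>" "x \<in> string_states Q \<rho>"
  obtains v i where "x = Trivial v i" "v \<in> verts Q" "i \<in> {-1, 1}"
  | xs where "x = Proper (Finite xs)" "is_string_list Q \<rho> xs"
  using assms(2) is_string_list_single[OF assms(1)]
  by (auto simp: string_states_def trivial_strings_def)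

lemma string_mia_automaton:
  assumes "string_algebra K Q \<rho>" "sign_maps Q \<rho> \<sigma> \<epsilon>"
  shows "multi_entry_inverse_automaton (string_mia Q \<rho> \<sigma> \<epsilon>)"
proof -
  interpret string_algebra K Q \<rho> by fact
  let ?e = "\<lambda>x. Trivial (string_tgt Q x) (string_epsilon \<sigma> \<epsilon> x)"
  have tgt: "letter_tgt Q b \<in> verts Q" if "b \<in> letters (arcs Q)" for b
    using that by (auto simp: letters_def)
  have e: "?e x \<in> trivial_strings Q" if "x \<in> string_states Q \<rho>" for x
    using assms(1) that
  proof (cases rule: string_states_cases)
    case (2 xs)
    then have "last xs \<in> letters (arcs Q)"
      by (auto simp: is_string_list_def)
    with 2 show ?thesis
      using tgt epsilon_sign_letter[OF assms(2)] by (auto simp: trivial_strings_def)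
  qed (auto simp: trivial_strings_def)
  have sub: "trivial_strings Q \<subseteq> string_states Q \<rho>"
    by (auto simp: string_states_def)
  have step: "\<exists>z. string_step Q \<rho> \<sigma> \<epsilon> (?e x) b = Some z \<and> ?e y = ?e z"
    if st: "string_step Q \<rho> \<sigma> \<epsilon> x b = Some y" for x b y
  proof -
    obtain us where us: "y = Proper (Finite us)" "us \<noteq> []" "last us = b"
      "x \<in> string_states Q \<rho>" "b \<in> letters (arcs Q)"
      using string_stepE[OF st] by metis
    have "letter_src Q b = string_tgt Q x \<and> letter_sigma \<sigma> \<epsilon> b = - string_epsilon \<sigma> \<epsilon> x"
      using assms(1) us(4)
    proof (cases rule: string_states_cases)
      case (1 v i)
      then show ?thesis using st by (auto simp: string_step_def split: if_splits)
    next
      case (2 xs)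
      with st have s: "is_string_list Q \<rho> (xs @ [b])"
        by (auto simp: string_step_def strings_def trivial_strings_def is_infinite_string_def
            split: if_splits)
      have xs: "xs = butlast xs @ [last xs]"
        using 2 by (auto simp: is_string_list_def)
      then have "xs @ [b] = butlast xs @ [last xs, b]"
        by (metis append.assoc append_Cons append_Nil)
      with s have s': "is_string_list Q \<rho> (butlast xs @ [last xs, b])" by simp
      then have "letter_tgt Q (last xs) = letter_src Q b"
        by (simp add: is_string_list_def successively_append_iff)
      moreover have "letter_epsilon \<sigma> \<epsilon> (last xs) = - letter_sigma \<sigma> \<epsilon> b"
        by (rule epsilon_sigma_letter[OF assms(2) s'])
      ultimately show ?thesis using 2 by simp
    qed
    then have "string_snoc Q \<sigma> \<epsilon> (?e x) b = Some (Proper (Finite [b]))" by simp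
    moreover have "Proper (Finite [b]) \<in> strings Q \<rho>"
      using is_string_list_single[OF assms(1) us(5)] by (auto simp: strings_def)
    moreover have "?e x \<in> string_states Q \<rho>"
      using e[OF us(4)] sub by blast
    ultimately obtain z where z: "string_step Q \<rho> \<sigma> \<epsilon> (?e x) b = Some z"
      using us(5) by (auto simp: string_step_def simp del: string_snoc.simps)
    obtain ws where "z = Proper (Finite ws)" "last ws = b"
      using string_stepE[OF z] by metis
    with z us(1,3) show ?thesis by auto
  qed
  show ?thesis
  proof (unfold_locales, goal_cases)
    case 1 then show ?case using finite_string_states[OF assms(1)] by (simp add: string_mia_def)
  next
    case 2 then show ?case using sub by (simp add: string_mia_def)
  next
    case (3 x) then show ?case using e by (simp add: string_mia_def)
  next
    case (4 v) then show ?case by (auto simp: string_mia_def trivial_strings_def)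
  next
    case 5 then show ?case by (simp add: string_mia_def)
  next
    case (6 x b y) then show ?case
      using string_stepE[of Q \<rho> \<sigma> \<epsilon> x b y] by (auto simp: string_mia_def)
  next
    case (7 x b y) then show ?case
      using string_stepE[of Q \<rho> \<sigma> \<epsilon> x b y] by (auto simp: string_mia_def)
  next
    case (8 v) then show ?case by (auto simp: string_mia_def trivial_strings_def)
  next
    case (9 v) then show ?case by (auto simp: string_mia_def trivial_strings_def)
  next
    case (10 v) then show ?case by (auto simp: string_mia_def trivial_strings_def)
  next
    case (11 x b y) then show ?case using step by (simp add: string_mia_def)
  qed
qed

end

theory Submission
  imports Defs
begin

text \<open>
  The automaton of a string algebra reads a letter list exactly as long as what it has read is a
  string.  The point is that the state, although it is only a suffix of the input, never forgets
  anything relevant: after reading \<open>u\<close> it is the longest suffix of \<open>u\<close> that is a state.  If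
  appending a letter \<open>b\<close> to the string \<open>u\<close> created a relation \<open>r\<close> or an inverse of one, then
  \<open>r\<close> would be a suffix \<open>z b\<close>; but \<open>z\<close>, a proper left part of \<open>r\<close>, is itself a
  state, hence lies inside the current state, and the automaton refuses the letter
  (\<open>steps_invariant\<close>).

  Consequently a triple \<open>(l, v, r)\<close> is a word over the automaton iff all concatenations of a
  finite suffix of \<open>l\<close> with a finite prefix of \<open>r\<close> are strings (or empty) and \<open>v\<close> is the
  zero-length string sitting between \<open>l\<close> and \<open>r\<close> (\<open>mia_words_iff\<close>).  In other words, it is
  a string \<open>l r\<close> with a marked cut; since every finite factor of \<open>l r\<close> lies in such a
  concatenation, all strings arise.  The marker \<open>v\<close> carries information only if both
  \<open>l\<close> and \<open>r\<close> are empty, because otherwise it can be read off from a letter next to the cut.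

  Two cuts of the same string differ by moving the cut across a finite word, also for words
  indexed by the integers, which are taken up to shift (\<open>word_append_eq_cases\<close>).  This is
  precisely the relation \<open>mia_sim\<close>.  So \<open>mia_sim\<close> is the kernel of \<open>word_to_string\<close>
  (\<open>mia_sim_eq_kernel\<close>), the image of this map is the set of all strings
  (\<open>word_to_string_image\<close>), and the theorem is the bijection between the quotient of a set by
  the kernel of a map and the image of that map (\<open>kernel_quotient\<close>).
\<close>

section \<open>Formal inverses and finite pieces of words\<close>

lemma list_inv_Nil [simp]: "list_inv [] = []"
  by (simp add: list_inv_def)

lemma list_inv_eq_Nil [simp]: "list_inv xs = [] \<longleftrightarrow> xs = []"
  by (simp add: list_inv_def)

lemma list_inv_append [simp]: "list_inv (xs @ ys) = list_inv ys @ list_inv xs"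
  by (simp add: list_inv_def)

lemma hd_list_inv: "xs \<noteq> [] \<Longrightarrow> hd (list_inv xs) = letter_inv (last xs)"
  by (simp add: list_inv_def hd_rev last_map)

lemma sublist_list_inv: "sublist (list_inv xs) ys \<longleftrightarrow> sublist xs (list_inv ys)"
proof -
  have "sublist (list_inv us) (list_inv vs)" if sub: "sublist us vs" for us vs :: "'a letter list"
  proof -
    obtain ps ss where "vs = ps @ us @ ss" using sub unfolding sublist_def by blast
    then have "list_inv vs = list_inv ss @ list_inv us @ list_inv ps" by simp
    then show ?thesis by (metis sublist_appendI)
  qed
  from this[of xs "list_inv ys"] this[of "list_inv xs" ys] show ?thesis
    by auto
qed

lemma prefix_list_inv: "prefix xs (list_inv ys) \<longleftrightarrow> suffix (list_inv xs) ys"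
  by (metis list_inv_append list_inv_inv prefix_def suffix_def)

text \<open>The words that may occur as right factors of a concatenation.\<close>

definition left_ended :: "'l word \<Rightarrow> bool" where
  "left_ended w \<longleftrightarrow> (\<exists>xs. w = Finite xs) \<or> (\<exists>s. w = RightInf s)"

text \<open>The words that may occur as left factors of a concatenation.\<close>

definition right_ended :: "'l word \<Rightarrow> bool" where
  "right_ended w \<longleftrightarrow> (\<exists>xs. w = Finite xs) \<or> (\<exists>s. w = LeftInf s)"

text \<open>
  The mirror image of \<open>finite_prefix\<close>.  With it left words can be described directly, without
  inverting them (\<open>finite_prefix_word_inv\<close>).
\<close>

fun finite_suffix :: "'l list \<Rightarrow> 'l word \<Rightarrow> bool" where
  "finite_suffix u (Finite xs) \<longleftrightarrow> suffix u xs"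
| "finite_suffix u (LeftInf s) \<longleftrightarrow> (\<exists>n. u = rev (stake n s))"
| "finite_suffix u _ \<longleftrightarrow> False"

lemma finite_prefix_word_inv: "finite_prefix u (word_inv w) \<longleftrightarrow> finite_suffix (list_inv u) w"
proof (cases w)
  case (LeftInf s)
  have "u = map letter_inv v \<longleftrightarrow> list_inv u = rev v" for v
    by (metis list_inv_def list_inv_inv rev_map rev_rev_ident)
  then show ?thesis using LeftInf by simp
qed (simp_all add: prefix_list_inv)

lemma left_ended_word_inv: "left_ended (word_inv w) \<longleftrightarrow> right_ended w"
  by (cases w) (auto simp: left_ended_def right_ended_def)

lemma finite_prefix_Nil: "left_ended w \<Longrightarrow> finite_prefix [] w"
  by (auto simp: left_ended_def) (metis stake.simps(1))

lemma finite_suffix_Nil: "right_ended w \<Longrightarrow> finite_suffix [] w"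
  by (auto simp: right_ended_def)

lemma finite_suffix_append:
  assumes "right_ended w"
  shows "finite_suffix d (word_append w (Finite u)) \<longleftrightarrow>
    suffix d u \<or> (\<exists>a. d = a @ u \<and> finite_suffix a w)"
proof (cases w)
  case (Finite xs)
  then show ?thesis by (auto simp: suffix_append)
next
  case (LeftInf s)
  have "(\<exists>n. d = rev (stake n (rev u @- s))) \<longleftrightarrow>
      suffix d u \<or> (\<exists>a. d = a @ u \<and> (\<exists>n. a = rev (stake n s)))" (is "?l \<longleftrightarrow> ?r")
  proof
    assume ?l
    then obtain n where n: "d = rev (stake (n - length u) s) @ rev (take n (rev u))"
      by (auto simp: stake_shift)
    show ?r
    proof (cases "n \<le> length u")
      case True
      then show ?thesis using n by (simp add: rev_take suffix_drop)
    next
      case False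
      then show ?thesis using n by auto
    qed
  next
    assume ?r
    then show ?l
    proof (elim disjE exE conjE)
      assume "suffix d u"
      then have "d = rev (stake (length d) (rev u @- s))"
        by (auto simp: suffix_def stake_shift)
      then show ?l by blast
    next
      fix a n assume "d = a @ u" "a = rev (stake n s)"
      then have "d = rev (stake (length u + n) (rev u @- s))"
        by (simp add: stake_shift)
      then show ?l by blast
    qed
  qed
  then show ?thesis using LeftInf by simp
qed (use assms in \<open>auto simp: right_ended_def\<close>)

lemma right_ended_append: "right_ended w \<Longrightarrow> right_ended (word_append w (Finite u))"
  by (auto simp: right_ended_def)

section \<open>Cutting words into two factors\<close>

text \<open>
  Moving a finite word across the cut does not change the concatenation.  If both factors are
  infinite, the two indexings by the integers differ, but only by a shift.
\<close>

lemma word_append_assoc_Finite: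
  assumes "right_ended l" "left_ended r"
  shows "word_append (word_append l (Finite u)) r = word_append l (word_append (Finite u) r)"
proof -
  have shift: "shift_class (bi_join (rev u @- s) t) = shift_class (bi_join s (u @- t))"
    for s t :: "'a stream"
  proof -
    have b: "bi_join (rev u @- s) t i = bi_join s (u @- t) (i + int (length u))" for i
      by (auto simp: bi_join_def rev_nth shift_snth nat_add_distrib nat_diff_distrib
          intro!: arg_cong[where f = "nth _"] arg_cong[where f = "snth _"])
    have c: "bi_join s (u @- t) i = bi_join (rev u @- s) t (i - int (length u))" for i
      by (simp add: b)
    show ?thesis
      unfolding shift_class_def
    proof (intro Collect_cong iffI; elim exE)
      fix g k assume "\<forall>i. g i = bi_join (rev u @- s) t (i + k)"
      then show "\<exists>k. \<forall>i. g i = bi_join s (u @- t) (i + k)"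
        by (intro exI[of _ "k + int (length u)"]) (simp add: b add.assoc)
    next
      fix g k assume "\<forall>i. g i = bi_join s (u @- t) (i + k)"
      then show "\<exists>k. \<forall>i. g i = bi_join (rev u @- s) t (i + k)"
        by (intro exI[of _ "k - int (length u)"]) (simp add: c algebra_simps)
    qed
  qed
  show ?thesis
    using assms by (auto simp: left_ended_def right_ended_def shift)
qed

text \<open>
  The letters around the cut of a bi-infinite word, in terms of the integer index: the cut is
  just before position 0.
\<close>

lemma bi_join_window:
  "rev (stake m l) @ stake n r = map (bi_join l r) [- int m..int n - 1]"
proof (rule nth_equalityI)
  fix i assume i: "i < length (rev (stake m l) @ stake n r)"
  then have "map (bi_join l r) [- int m..int n - 1] ! i = bi_join l r (int i - int m)"
    by simp
  also have "\<dots> = (rev (stake m l) @ stake n r) ! i"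
  proof (cases "i < m")
    case True
    then have "nat (- (int i - int m) - 1) = m - Suc i" by linarith
    with True show ?thesis by (simp add: nth_append rev_nth bi_join_def)
  next
    case False
    then have "nat (int i - int m) = i - m" by linarith
    with False i show ?thesis by (simp add: nth_append bi_join_def)
  qed
  finally show "(rev (stake m l) @ stake n r) ! i = map (bi_join l r) [- int m..int n - 1] ! i"
    by simp
qed simp

text \<open>
  Together with \<open>finite_factors_append\<close> this says that the finite factors of a concatenation are
  controlled by those factors that touch the cut from both sides; these are the ones that the
  definition of a word over an automaton speaks about.
\<close>

lemma append_in_finite_factors:
  assumes "finite_suffix a l" "finite_prefix b r"
  shows "a @ b \<in> finite_factors (word_append l r)"
proof (cases l; cases r)
  fix xs ys assume lr: "l = Finite xs" "r = Finite ys"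
  then obtain p q where "xs = p @ a" "ys = b @ q"
    using assms by (auto simp: suffix_def prefix_def)
  then show ?thesis using lr sublist_appendI[of "a @ b" p q] by simp
next
  fix xs s assume lr: "l = Finite xs" "r = RightInf s"
  then obtain p n where "xs = p @ a" "b = stake n s"
    using assms by (auto simp: suffix_def)
  then have "a @ b = stake (length a + n) (sdrop (length p) (xs @- s))"
    by (simp add: sdrop_shift stake_shift)
  then show ?thesis using lr by auto
next
  fix s ys assume lr: "l = LeftInf s" "r = Finite ys"
  then obtain q n where "ys = b @ q" "a = rev (stake n s)"
    using assms by (auto simp: prefix_def)
  then have "a @ b = rev (stake (length b + n) (sdrop (length q) (rev ys @- s)))"
    by (simp add: sdrop_shift stake_shift)
  then show ?thesis using lr by auto
next
  fix s t assume lr: "l = LeftInf s" "r = RightInf t"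
  then obtain m n where "a @ b = rev (stake m s) @ stake n t"
    using assms by auto
  then have "a @ b = map (bi_join s t) [- int m..int n - 1]"
    by (simp only: bi_join_window)
  moreover have "bi_join s t \<in> shift_class (bi_join s t)"
    by (auto simp: shift_class_def intro: exI[of _ 0])
  ultimately show ?thesis using lr by auto
qed (use assms in auto)

lemma sublist_stake:
  assumes "m + n \<le> N"
  shows "sublist (stake n (sdrop m s)) (stake N s)"
proof -
  have "stake N s = stake m s @ stake n (sdrop m s) @ stake (N - (m + n)) (sdrop (m + n) s)"
    using assms by (metis append_assoc le_add_diff_inverse stake_add)
  then show ?thesis by (metis sublist_appendI)
qed

lemma finite_factors_append:
  assumes "right_ended l" "left_ended r" "u \<in> finite_factors (word_append l r)"
  obtains a b where "finite_suffix a l" "finite_prefix b r" "sublist u (a @ b)"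
proof (cases l; cases r)
  fix xs ys assume "l = Finite xs" "r = Finite ys"
  then show ?thesis using assms that[of xs ys] by simp
next
  fix xs s assume lr: "l = Finite xs" "r = RightInf s"
  then obtain m n where "u = stake n (sdrop m (xs @- s))"
    using assms by auto
  then have "sublist u (stake (length xs + (m + n)) (xs @- s))"
    by (simp add: sublist_stake)
  then have "sublist u (xs @ stake (m + n) s)"
    by (simp add: stake_shift)
  then show ?thesis using lr by (intro that[of xs "stake (m + n) s"]) auto
next
  fix s ys assume lr: "l = LeftInf s" "r = Finite ys"
  then obtain m n where "u = rev (stake n (sdrop m (rev ys @- s)))"
    using assms by auto
  then have "sublist u (rev (stake (length ys + (m + n)) (rev ys @- s)))"
    by (simp add: sublist_stake)
  then have "sublist u (rev (stake (m + n) s) @ ys)"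
    by (simp add: stake_shift)
  then show ?thesis using lr by (intro that[of "rev (stake (m + n) s)" ys]) auto
next
  fix s t assume lr: "l = LeftInf s" "r = RightInf t"
  then obtain g i j k where g: "\<And>x. g x = bi_join s t (x + k)" and u: "u = map g [i..j]"
    using assms(3) by (auto simp: shift_class_def)
  have u': "u = map (bi_join s t) [i + k..j + k]"
    unfolding u by (rule nth_equalityI) (auto simp: g algebra_simps)
  \<comment> \<open>A window around the cut that is wide enough to contain the positions from \<open>i + k\<close> to \<open>j + k\<close>.\<close>
  define N where "N = nat (\<bar>i + k\<bar> + \<bar>j + k\<bar> + 1)"
  have "sublist [i + k..j + k] [- int N..int N - 1]"
  proof (cases "i + k \<le> j + k")
    case True
    then have "[- int N..int N - 1] =
        [- int N..i + k - 1] @ [i + k..j + k] @ [j + k + 1..int N - 1]"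
      by (simp add: N_def flip: upto_split1 upto_split2 append_assoc)
    then show ?thesis by (metis sublist_appendI)
  qed simp
  then have "sublist u (rev (stake N s) @ stake N t)"
    unfolding u' bi_join_window by (rule map_mono_sublist)
  then show ?thesis using lr by (intro that[of "rev (stake N s)" "stake N t"]) auto
qed (use assms in \<open>auto simp: left_ended_def right_ended_def\<close>)

lemma shift_eq_shift_cases:
  assumes "xs @- s = ys @- t"
  shows "\<exists>u. (xs = ys @ u \<and> t = u @- s) \<or> (ys = xs @ u \<and> s = u @- t)"
  using assms
proof (induction xs arbitrary: ys)
  case (Cons x xs)
  then show ?case by (cases ys) fastforce+
qed auto

lemma stream_eqI: "(\<And>n. s !! n = t !! n) \<Longrightarrow> s = t"
  by (metis ext stream_smap_nats)

text \<open>
  If two cuts of one bi-infinite word are given by indexings that differ by \<open>k\<close>, then the second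
  cut lies \<open>k\<close> letters to the right of the first.
\<close>

lemma bi_join_shift:
  assumes "\<And>i. bi_join l2 r2 i = bi_join l1 r1 (i + int k)"
  shows "l2 = rev (stake k r1) @- l1 \<and> r1 = stake k r1 @- r2"
proof
  have "l2 !! n = (rev (stake k r1) @- l1) !! n" for n
    using assms[of "- int n - 1"]
    by (auto simp: bi_join_def shift_snth rev_nth nat_diff_distrib split: if_splits
       intro!: arg_cong[where f = "snth _"])
  then show "l2 = rev (stake k r1) @- l1"
    by (rule stream_eqI)
  have "r2 !! n = sdrop k r1 !! n" for n
    using assms[of "int n"] by (simp add: bi_join_def sdrop_snth nat_add_distrib add.commute)
  then have "r2 = sdrop k r1"
    by (rule stream_eqI)
  then show "r1 = stake k r1 @- r2"
    by (simp add: stake_sdrop)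
qed

text \<open>
  The converse of \<open>word_append_assoc_Finite\<close>: two cuts of the same word are a finite distance
  apart.  For bi-infinite words the distance is a shift that identifies the two indexings; if the
  word is periodic there are several such shifts, and any of them will do.
\<close>

lemma word_append_eq_cases:
  assumes "right_ended l1" "left_ended r1" "right_ended l2" "left_ended r2"
    and eq: "word_append l1 r1 = word_append l2 r2"
  shows "\<exists>u. (l1 = word_append l2 (Finite u) \<and> r2 = word_append (Finite u) r1) \<or>
    (l2 = word_append l1 (Finite u) \<and> r1 = word_append (Finite u) r2)"
proof (cases l1; cases r1)
  fix xs ys assume 1: "l1 = Finite xs" "r1 = Finite ys"
  then obtain xs' ys' where 2: "l2 = Finite xs'" "r2 = Finite ys'"
    using assms by (auto simp: left_ended_def right_ended_def)
  then have "xs @ ys = xs' @ ys'" using 1 eq by simp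
  then obtain u where "(xs = xs' @ u \<and> ys' = u @ ys) \<or> (xs' = xs @ u \<and> ys = u @ ys')"
    by (auto simp: append_eq_append_conv2)
  then show ?thesis using 1 2 by auto
next
  fix xs s assume 1: "l1 = Finite xs" "r1 = RightInf s"
  then obtain xs' s' where 2: "l2 = Finite xs'" "r2 = RightInf s'"
    using assms by (auto simp: left_ended_def right_ended_def)
  then have "xs @- s = xs' @- s'" using 1 eq by simp
  from shift_eq_shift_cases[OF this] show ?thesis using 1 2 by auto
next
  fix s ys assume 1: "l1 = LeftInf s" "r1 = Finite ys"
  then obtain s' ys' where 2: "l2 = LeftInf s'" "r2 = Finite ys'"
    using assms by (auto simp: left_ended_def right_ended_def)
  then have "rev ys @- s = rev ys' @- s'" using 1 eq by simp
  from shift_eq_shift_cases[OF this] obtain u where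
    "(rev ys = rev ys' @ u \<and> s' = u @- s) \<or> (rev ys' = rev ys @ u \<and> s = u @- s')" by blast
  then have "(ys = rev u @ ys' \<and> s' = u @- s) \<or> (ys' = rev u @ ys \<and> s = u @- s')"
    by (metis rev_append rev_rev_ident)
  then show ?thesis using 1 2 by (intro exI[of _ "rev u"]) auto
next
  fix s t assume 1: "l1 = LeftInf s" "r1 = RightInf t"
  then obtain s' t' where 2: "l2 = LeftInf s'" "r2 = RightInf t'"
    using assms by (auto simp: left_ended_def right_ended_def)
  have "bi_join s' t' \<in> shift_class (bi_join s' t')"
    by (auto simp: shift_class_def intro: exI[of _ 0])
  also have "\<dots> = shift_class (bi_join s t)" using 1 2 eq by simp
  finally obtain k where k: "\<And>i. bi_join s' t' i = bi_join s t (i + k)"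
    by (auto simp: shift_class_def)
  show ?thesis
  proof (cases "0 \<le> k")
    case True
    then have "\<And>i. bi_join s' t' i = bi_join s t (i + int (nat k))" using k by simp
    from bi_join_shift[OF this] show ?thesis
      using 1 2 by (intro exI[of _ "stake (nat k) t"]) simp
  next
    case False
    then have "\<And>i. bi_join s t i = bi_join s' t' (i + int (nat (- k)))"
      using k by simp
    from bi_join_shift[OF this] show ?thesis
      using 1 2 by (intro exI[of _ "stake (nat (- k)) t'"]) simp
  qed
qed (use assms in \<open>auto simp: left_ended_def right_ended_def\<close>)

text \<open>
  A nonempty factor has a letter next to the cut, and all its finite parts touching the cut
  contain it.  This letter determines the zero-length string at the cut.
\<close>

lemma first_letter:
  assumes "left_ended w" "w \<noteq> Finite []"
  obtains c where "finite_prefix [c] w" "\<And>u. \<lbrakk>finite_prefix u w; u \<noteq> []\<rbrakk> \<Longrightarrow> hd u = c"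
proof (cases w)
  case (Finite xs)
  then have "xs = [hd xs] @ tl xs" using assms by simp
  then have "finite_prefix [hd xs] w"
    using Finite by (metis finite_prefix.simps(1) prefixI)
  moreover have "hd u = hd xs" if "finite_prefix u w" "u \<noteq> []" for u
    using that Finite by (auto simp: prefix_def)
  ultimately show ?thesis by (rule that)
next
  case (RightInf s)
  have "finite_prefix [shd s] w"
    using RightInf by (auto intro: exI[of _ 1])
  moreover have "hd u = shd s" if u: "finite_prefix u w" "u \<noteq> []" for u
  proof -
    obtain n where "u = stake n s" using RightInf u by auto
    then show ?thesis using u by (cases n) auto
  qed
  ultimately show ?thesis by (rule that)
qed (use assms in \<open>auto simp: left_ended_def\<close>)

lemma last_letter:
  assumes "right_ended w" "w \<noteq> Finite []"
  obtains c where "finite_suffix [c] w" "\<And>u. \<lbrakk>finite_suffix u w; u \<noteq> []\<rbrakk> \<Longrightarrow> last u = c"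
proof (cases w)
  case (Finite xs)
  then have "xs \<noteq> []" using assms by simp
  then have "xs = butlast xs @ [last xs]" by simp
  then have "finite_suffix [last xs] w"
    using Finite by (metis finite_suffix.simps(1) suffixI)
  moreover have "last u = last xs" if "finite_suffix u w" "u \<noteq> []" for u
    using that Finite by (auto simp: suffix_def)
  ultimately show ?thesis by (rule that)
next
  case (LeftInf s)
  have "finite_suffix [shd s] w"
    using LeftInf by (auto intro: exI[of _ 1])
  moreover have "last u = shd s" if u: "finite_suffix u w" "u \<noteq> []" for u
  proof -
    obtain n where "u = rev (stake n s)" using LeftInf u by auto
    then show ?thesis using u by (cases n) auto
  qed
  ultimately show ?thesis by (rule that)
qed (use assms in \<open>auto simp: right_ended_def\<close>)

section \<open>The quotient by the kernel of a map\<close>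

lemma kernel_quotient:
  assumes "R = {(x, y). x \<in> A \<and> y \<in> A \<and> f x = f y}"
  shows "equiv A R" "f respects R" "bij_betw (\<lambda>C. the_elem (f ` C)) (A // R) (f ` A)"
proof -
  show equiv: "equiv A R"
    unfolding assms by (rule equivI) (auto simp: refl_on_def sym_def trans_def)
  show resp: "f respects R"
    unfolding assms by (auto simp: congruent_def)
  have val: "the_elem (f ` (R `` {x})) = f x" if "x \<in> A" for x
  proof -
    have "f ` (R `` {x}) = {f x}" using that by (auto simp: assms)
    then show ?thesis by simp
  qed
  show "bij_betw (\<lambda>C. the_elem (f ` C)) (A // R) (f ` A)"
  proof (rule bij_betw_imageI)
    show "inj_on (\<lambda>C. the_elem (f ` C)) (A // R)"
    proof (rule inj_onI)
      fix C D assume "C \<in> A // R" "D \<in> A // R" and eq: "the_elem (f ` C) = the_elem (f ` D)"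
      then obtain x y where xy: "x \<in> A" "y \<in> A" "C = R `` {x}" "D = R `` {y}"
        by (auto elim!: quotientE)
      then have "(x, y) \<in> R" using eq val by (simp add: assms)
      then show "C = D" unfolding xy by (rule equiv_class_eq[OF equiv])
    qed
    show "(\<lambda>C. the_elem (f ` C)) ` (A // R) = f ` A"
    proof -
      have "(\<lambda>C. the_elem (f ` C)) ` (A // R) = (\<lambda>x. the_elem (f ` (R `` {x}))) ` A"
        by (simp add: quotient_def image_UN image_image UNION_singleton_eq_range)
      also have "\<dots> = f ` A" using val by (rule image_cong[OF refl])
      finally show ?thesis .
    qed
  qed
qed


section \<open>Finite strings\<close>

lemma letter_src_inv [simp]: "letter_src Q (letter_inv x) = letter_tgt Q x"
  by (cases x) auto

lemma letter_tgt_inv [simp]: "letter_tgt Q (letter_inv x) = letter_src Q x"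
  by (cases x) auto

lemma letter_sigma_inv [simp]: "letter_sigma \<sigma> \<epsilon> (letter_inv x) = letter_epsilon \<sigma> \<epsilon> x"
  by (cases x) auto

lemma is_string_list_sublist:
  assumes "is_string_list Q \<rho> ys" "sublist xs ys" "xs \<noteq> []"
  shows "is_string_list Q \<rho> xs"
proof -
  have "set xs \<subseteq> set ys" using assms(2) by (rule set_mono_sublist)
  moreover have "successively P xs" if "successively P ys" for P
    using assms(2) that by (auto simp: sublist_def successively_append_iff)
  moreover have "sublist u ys" if "sublist u xs" for u
    using that assms(2) by (rule sublist_order.order_trans)
  ultimately show ?thesis
    using assms(1,3) unfolding is_string_list_def by blast
qed

lemma is_string_list_inv:
  assumes "is_string_list Q \<rho> xs"
  shows "is_string_list Q \<rho> (list_inv xs)"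
proof -
  have "successively (\<lambda>x y. letter_tgt Q x = letter_src Q y \<and> x \<noteq> letter_inv y) (list_inv xs)
      \<longleftrightarrow> successively (\<lambda>x y. letter_tgt Q x = letter_src Q y \<and> x \<noteq> letter_inv y) xs"
    unfolding list_inv_def successively_rev successively_map
    by (rule successively_cong) (auto simp: eq_commute)
  moreover have "set (list_inv xs) \<subseteq> letters (arcs Q)" if "set xs \<subseteq> letters (arcs Q)"
    using that by (auto simp: list_inv_def letters_def image_iff subset_iff)
  ultimately show ?thesis
    using assms unfolding is_string_list_def
    by (metis list_inv_eq_Nil list_inv_inv sublist_list_inv)
qed

locale signed_string_algebra = string_algebra K Q \<rho> + sign_maps Q \<rho> \<sigma> \<epsilon>
  for K :: "'k ring" and Q :: "('v, 'a) pre_digraph" and \<rho> :: "'a list set"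
    and \<sigma> \<epsilon> :: "'a \<Rightarrow> int"
begin

abbreviation M :: "(('v, 'a) qstring, 'a) mia" where
  "M \<equiv> string_mia Q \<rho> \<sigma> \<epsilon>"

text \<open>
  The unique zero-length strings that can be multiplied to \<open>u\<close> from the left (\<open>start_point\<close>)
  and from the right (\<open>end_point\<close>), for nonempty \<open>u\<close>.
\<close>

definition start_point :: "'a letter list \<Rightarrow> ('v, 'a) qstring" where
  "start_point u = Trivial (letter_src Q (hd u)) (- letter_sigma \<sigma> \<epsilon> (hd u))"

definition end_point :: "'a letter list \<Rightarrow> ('v, 'a) qstring" where
  "end_point u = Trivial (letter_tgt Q (last u)) (letter_epsilon \<sigma> \<epsilon> (last u))"

text \<open>
  The empty list is no string, but it is a legitimate input of the automaton and a factor of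
  every word.
\<close>

definition admissible :: "'a letter list \<Rightarrow> bool" where
  "admissible u \<longleftrightarrow> u = [] \<or> is_string_list Q \<rho> u"

lemma admissible_Nil [simp]: "admissible []"
  by (simp add: admissible_def)

lemma admissible_sublist: "\<lbrakk>admissible v; sublist u v\<rbrakk> \<Longrightarrow> admissible u"
  using is_string_list_sublist by (auto simp: admissible_def)

lemma admissible_list_inv [simp]: "admissible (list_inv u) \<longleftrightarrow> admissible u"
  using is_string_list_inv[of Q \<rho> u] is_string_list_inv[of Q \<rho> "list_inv u"]
  by (auto simp: admissible_def)

lemma string_inv_start_point:
  assumes "u \<noteq> []"
  shows "start_point (list_inv u) = string_inv (end_point u)"
  using assms by (simp add: start_point_def end_point_def hd_list_inv)

text \<open>
  By the sign condition on consecutive letters of a string, both sides of a cut agree on the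
  zero-length string at the cut.
\<close>

lemma end_point_eq_start_point:
  assumes "admissible (a @ b)" "a \<noteq> []" "b \<noteq> []"
  shows "end_point a = start_point b"
proof -
  have "a = butlast a @ [last a]" "b = [hd b] @ tl b"
    using assms(2,3) by simp_all
  then have "a @ b = (butlast a @ [last a, hd b]) @ tl b"
    by (metis append.assoc append_Cons append_Nil)
  then have "sublist (butlast a @ [last a, hd b]) (a @ b)"
    using sublist_append_rightI by metis
  then have s: "is_string_list Q \<rho> (butlast a @ [last a, hd b])"
    using admissible_sublist[OF assms(1)] by (auto simp: admissible_def)
  then have "letter_tgt Q (last a) = letter_src Q (hd b)"
    by (simp add: is_string_list_def successively_append_iff)
  with epsilon_sigma_letter[OF sign_maps_axioms s] show ?thesis
    by (simp add: end_point_def start_point_def)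
qed

lemma end_point_trivial:
  assumes "admissible u" "u \<noteq> []"
  shows "end_point u \<in> trivial_strings Q"
proof -
  have l: "last u \<in> letters (arcs Q)"
    using assms by (auto simp: admissible_def is_string_list_def)
  then have "letter_tgt Q (last u) \<in> verts Q"
    by (auto simp: letters_def)
  then show ?thesis
    using epsilon_sign_letter[OF sign_maps_axioms l]
    by (auto simp: end_point_def trivial_strings_def)
qed

lemma string_inv_trivial: "v \<in> trivial_strings Q \<Longrightarrow> string_inv v \<in> trivial_strings Q"
  by (auto simp: trivial_strings_def)

lemma start_point_trivial:
  assumes "admissible u" "u \<noteq> []"
  shows "start_point u \<in> trivial_strings Q"
  using end_point_trivial[of "list_inv u"] string_inv_start_point[of "list_inv u"] assms
    string_inv_trivial by simp


section \<open>The automaton recognises strings\<close>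

text \<open>
  The length-maximal suffix that is a state also contains all other suffixes that are states,
  since suffixes of one list are linearly ordered.  Inclusion is what the induction below uses.
\<close>

definition longest_state_suffix :: "'a letter list \<Rightarrow> 'a letter list \<Rightarrow> bool" where
  "longest_state_suffix ys xs \<longleftrightarrow>
     ys \<noteq> [] \<and> Proper (Finite ys) \<in> string_states Q \<rho> \<and> suffix ys xs \<and>
     (\<forall>zs. zs \<noteq> [] \<longrightarrow> Proper (Finite zs) \<in> string_states Q \<rho> \<longrightarrow> suffix zs xs \<longrightarrow> suffix zs ys)"

lemma string_step_eq_Some:
  assumes "string_step Q \<rho> \<sigma> \<epsilon> x b = Some y"
  obtains xs ys where "string_snoc Q \<sigma> \<epsilon> x b = Some (Proper (Finite xs))"
    "is_string_list Q \<rho> xs" "y = Proper (Finite ys)" "longest_state_suffix ys xs"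
proof -
  obtain ys where y: "y = Proper (Finite ys)" "ys \<noteq> []" "y \<in> string_states Q \<rho>"
    and b: "b \<in> letters (arcs Q)"
    using string_stepE[OF assms] by metis
  obtain w where w: "string_snoc Q \<sigma> \<epsilon> x b = Some w" "w \<in> strings Q \<rho>"
    and y_def: "y = (ARG_MAX string_length z. z \<in> string_states Q \<rho> \<and> right_substring Q \<sigma> \<epsilon> z w)"
    using assms by (auto simp: string_step_def split: if_splits option.splits)
  obtain xs where xs: "w = Proper (Finite (xs @ [b]))"
  proof (cases x)
    case (Trivial v i)
    then show thesis using that[of "[]"] w(1) by (simp split: if_splits)
  next
    case (Proper u)
    then show thesis using that w(1) by (cases u) auto
  qed
  \<comment> \<open>The maximum in the transition function is over a set of bounded lengths containing \<open>[b]\<close>.\<close>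
  let ?P = "\<lambda>z. z \<in> string_states Q \<rho> \<and> right_substring Q \<sigma> \<epsilon> z w"
  have P: "?P (Proper (Finite [b]))"
    using b xs by (auto simp: string_states_def right_substring_def)
  have "\<forall>z. ?P z \<longrightarrow> string_length z < Suc (length xs + 1)"
    using suffix_length_le by (fastforce simp: right_substring_def xs)
  from arg_max_nat_lemma[of ?P, OF P this]
  have Py: "?P y" and max: "\<And>z. ?P z \<Longrightarrow> string_length z \<le> string_length y"
    unfolding y_def by blast+
  have "longest_state_suffix ys (xs @ [b])"
    unfolding longest_state_suffix_def
  proof (intro conjI allI impI)
    show "ys \<noteq> []" by fact
    show "Proper (Finite ys) \<in> string_states Q \<rho>" using y by simp
    show suf: "suffix ys (xs @ [b])" using Py y by (auto simp: right_substring_def xs)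
    fix zs :: "'a letter list"
    assume "zs \<noteq> []" "Proper (Finite zs) \<in> string_states Q \<rho>" "suffix zs (xs @ [b])"
    moreover from this have "length zs \<le> length ys"
      using max[of "Proper (Finite zs)"] by (simp add: right_substring_def xs y(1))
    ultimately show "suffix zs ys" using suf suffix_length_suffix by blast
  qed
  moreover have "is_string_list Q \<rho> (xs @ [b])"
    using w(2) by (auto simp: xs strings_def trivial_strings_def is_infinite_string_def)
  ultimately show thesis using that w(1) xs y(1) by blast
qed

lemma string_step_defined:
  assumes "x \<in> string_states Q \<rho>" "string_snoc Q \<sigma> \<epsilon> x b = Some (Proper (Finite xs))"
    and "is_string_list Q \<rho> xs" "b \<in> letters (arcs Q)"
  shows "string_step Q \<rho> \<sigma> \<epsilon> x b \<noteq> None"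
  using assms by (auto simp: string_step_def strings_def)

lemma suffix_of_longest_state:
  assumes "longest_state_suffix ys u" "suffix (zs @ [b]) (u @ [b])"
    and "zs \<noteq> [] \<Longrightarrow> Proper (Finite zs) \<in> string_states Q \<rho>"
  shows "suffix (zs @ [b]) (ys @ [b])"
  using assms by (cases "zs = []") (auto simp: longest_state_suffix_def suffix_def)

text \<open>
  Why it suffices to remember the longest suffix that is a state: a relation (or inverse of one) \<open>z b\<close>
  completed by
  \<open>b\<close> has its proper left part \<open>z\<close> inside \<open>ys\<close>, so \<open>ys b\<close> would already contain it.
\<close>

lemma is_string_list_snoc:
  assumes ys: "longest_state_suffix ys u" and u: "is_string_list Q \<rho> u"
    and ysb: "is_string_list Q \<rho> (ys @ [b])"
  shows "is_string_list Q \<rho> (u @ [b])"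
proof -
  have ys': "ys \<noteq> []" "suffix ys u"
    using ys by (auto simp: longest_state_suffix_def)
  then have last: "last u = last ys" by (auto simp: suffix_def)
  have "w \<notin> map Pos ` \<rho> \<and> list_inv w \<notin> map Pos ` \<rho>" if w: "sublist w (u @ [b])" for w
  proof (cases "sublist w u")
    case True
    then show ?thesis using u by (simp add: is_string_list_def)
  next
    case False
    obtain p q where pq: "u @ [b] = p @ w @ q"
      using w unfolding sublist_def by blast
    have "q = []"
    proof (rule ccontr)
      assume "q \<noteq> []"
      then have "u = p @ w @ butlast q"
        using pq by (metis append_butlast_last_id butlast_append butlast_snoc append_is_Nil_conv)
      with False show False by (simp add: sublist_appendI)
    qed
    with pq have "suffix w (u @ [b])" by (simp add: suffix_def)
    then obtain zs where zs: "w = zs @ [b]" "suffix zs u"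
      using False by (auto simp: suffix_snoc)
    show ?thesis
    proof (rule ccontr)
      assume "\<not> ?thesis"
      then have rel: "w \<in> map Pos ` \<rho> \<or> list_inv w \<in> map Pos ` \<rho>" by blast
      have "Proper (Finite zs) \<in> string_states Q \<rho>" if "zs \<noteq> []"
      proof -
        have "is_string_list Q \<rho> zs"
          using is_string_list_sublist[OF u _ that] zs(2) by (simp add: suffix_imp_sublist)
        moreover have "strict_prefix zs w" by (auto simp: zs(1) strict_prefix_def)
        ultimately show ?thesis using rel by (auto simp: string_states_def)
      qed
      then have "suffix w (ys @ [b])"
        using suffix_of_longest_state[OF ys, of zs b] zs by simp
      then have "sublist w (ys @ [b])" by (rule suffix_imp_sublist)
      then show False using ysb rel by (auto simp: is_string_list_def)
    qed
  qed
  then show ?thesis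
    using u ysb last ys' by (auto simp: is_string_list_def successively_append_iff)
qed

text \<open>
  States of length at least two are proper left parts of relations or of inverses of relations,
  so that they remain states
  when their last letter is removed.  Therefore the longest suffix of \<open>u b\<close> that is a state can be
  computed from the longest one of \<open>u\<close>.
\<close>

lemma longest_state_suffix_snoc:
  assumes ys: "longest_state_suffix ys u" and zs: "longest_state_suffix zs (ys @ [b])"
  shows "longest_state_suffix zs (u @ [b])"
proof -
  have "suffix (ys @ [b]) (u @ [b])"
    using ys by (simp add: longest_state_suffix_def)
  then have "suffix zs (u @ [b])"
    using zs suffix_order.order_trans unfolding longest_state_suffix_def by blast
  moreover have "suffix ws zs"
    if ws: "ws \<noteq> []" "Proper (Finite ws) \<in> string_states Q \<rho>" "suffix ws (u @ [b])" for ws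
  proof -
    obtain ws' where ws': "ws = ws' @ [b]"
      using ws(1,3) by (auto simp: suffix_snoc)
    have "Proper (Finite ws') \<in> string_states Q \<rho>" if ne: "ws' \<noteq> []"
    proof -
      have "is_string_list Q \<rho> ws" "\<exists>r. (r \<in> map Pos ` \<rho> \<or> list_inv r \<in> map Pos ` \<rho>) \<and> strict_prefix ws r"
        using ws(2) ne by (auto simp: ws' string_states_def trivial_strings_def)
      moreover have "strict_prefix ws' ws" by (auto simp: ws' strict_prefix_def)
      moreover have "is_string_list Q \<rho> ws'"
        using is_string_list_sublist[OF \<open>is_string_list Q \<rho> ws\<close> _ ne] by (simp add: ws')
      ultimately show ?thesis
        unfolding string_states_def by (blast intro: prefix_order.less_trans)
    qed
    then have "suffix ws (ys @ [b])"
      using suffix_of_longest_state[OF ys, of ws' b] ws(3) unfolding ws' by blast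
    then show ?thesis using zs ws unfolding longest_state_suffix_def by blast
  qed
  ultimately show ?thesis using zs by (auto simp: longest_state_suffix_def)
qed

text \<open>
  The invariant of a run: its states are the longest suffixes, and it does not stop before the
  input stops being a string.  An initial state only restricts the first letter.
\<close>

lemma steps_invariant:
  assumes v: "v \<in> trivial_strings Q" and "u \<noteq> []"
  shows "(\<forall>y. steps M v u = Some y \<longrightarrow> is_string_list Q \<rho> u \<and> v = start_point u \<and>
        (\<exists>ys. y = Proper (Finite ys) \<and> longest_state_suffix ys u)) \<and>
      (is_string_list Q \<rho> u \<and> v = start_point u \<longrightarrow> steps M v u \<noteq> None)"
  using assms(2)
proof (induction u rule: rev_nonempty_induct)
  case (single b)
  have steps: "steps M v [b] = string_step Q \<rho> \<sigma> \<epsilon> v b"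
    using steps_snoc[of M v "[]" b] by (simp add: string_mia_def)
  have snoc: "string_snoc Q \<sigma> \<epsilon> v b = (if v = start_point [b] then Some (Proper (Finite [b])) else None)"
    using v by (auto simp: trivial_strings_def start_point_def split: if_splits)
  have state: "v \<in> string_states Q \<rho>"
    using v by (simp add: string_states_def)
  show ?case
  proof (intro conjI allI impI; (elim conjE)?)
    fix y assume "steps M v [b] = Some y"
    then show "is_string_list Q \<rho> [b]" "v = start_point [b]"
        "\<exists>ys. y = Proper (Finite ys) \<and> longest_state_suffix ys [b]"
      unfolding steps by (auto elim!: string_step_eq_Some simp: snoc split: if_splits)
  next
    assume b: "is_string_list Q \<rho> [b]" "v = start_point [b]"
    then have "b \<in> letters (arcs Q)" by (simp add: is_string_list_def)
    then show "steps M v [b] \<noteq> None"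
      unfolding steps using b(1) snoc[folded b(2)] by (intro string_step_defined[OF state, of b "[b]"]) simp_all
  qed
next
  case (snoc b u)
  have steps: "steps M v (u @ [b]) = Option.bind (steps M v u) (\<lambda>x. string_step Q \<rho> \<sigma> \<epsilon> x b)"
    by (simp add: string_mia_def)
  have start: "start_point (u @ [b]) = start_point u"
    using \<open>u \<noteq> []\<close> by (simp add: start_point_def)
  show ?case
  proof (intro conjI allI impI; (elim conjE)?)
    fix y assume "steps M v (u @ [b]) = Some y"
    then obtain x where x: "steps M v u = Some x" "string_step Q \<rho> \<sigma> \<epsilon> x b = Some y"
      unfolding steps by (auto simp: bind_eq_Some_conv)
    obtain ys where ys: "x = Proper (Finite ys)" "longest_state_suffix ys u"
      and u: "is_string_list Q \<rho> u" "v = start_point u"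
      using snoc.IH x(1) by blast
    obtain zs where zs: "is_string_list Q \<rho> (ys @ [b])" "y = Proper (Finite zs)"
      "longest_state_suffix zs (ys @ [b])"
      using x(2) unfolding ys(1) by (auto elim!: string_step_eq_Some)
    show "is_string_list Q \<rho> (u @ [b])" using is_string_list_snoc[OF ys(2) u(1) zs(1)] .
    show "v = start_point (u @ [b])" using u(2) start by simp
    show "\<exists>ys. y = Proper (Finite ys) \<and> longest_state_suffix ys (u @ [b])"
      using longest_state_suffix_snoc[OF ys(2) zs(3)] zs(2) by blast
  next
    assume ub: "is_string_list Q \<rho> (u @ [b])" "v = start_point (u @ [b])"
    then have "is_string_list Q \<rho> u"
      using is_string_list_sublist[OF ub(1), of u] \<open>u \<noteq> []\<close> by simp
    then obtain x where x: "steps M v u = Some x"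
      using snoc.IH ub(2) start by auto
    then obtain ys where ys: "x = Proper (Finite ys)" "longest_state_suffix ys u"
      using snoc.IH by blast
    then have "suffix (ys @ [b]) (u @ [b])" "ys \<noteq> []" by (auto simp: longest_state_suffix_def)
    then have "is_string_list Q \<rho> (ys @ [b])"
      by (intro is_string_list_sublist[OF ub(1)] suffix_imp_sublist) auto
    then have "string_step Q \<rho> \<sigma> \<epsilon> x b \<noteq> None"
      using ys by (intro string_step_defined[of x b "ys @ [b]"])
        (auto simp: longest_state_suffix_def is_string_list_def)
    then show "steps M v (u @ [b]) \<noteq> None" unfolding steps x by simp
  qed
qed

lemma steps_defined_iff:
  assumes "v \<in> trivial_strings Q"
  shows "steps M v u \<noteq> None \<longleftrightarrow> admissible u \<and> (u \<noteq> [] \<longrightarrow> v = start_point u)"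
proof (cases "u = []")
  case False
  then show ?thesis using steps_invariant[OF assms False] by (auto simp: admissible_def)
qed simp

text \<open>
  The entry of a state depends only on its last letter, which is the last letter read.
\<close>

lemma entry_steps:
  assumes "v \<in> trivial_strings Q" "steps M v u = Some y"
  shows "entry M y = (if u = [] then v else end_point u)"
proof (cases "u = []")
  case True
  then show ?thesis using assms by (auto simp: string_mia_def trivial_strings_def)
next
  case False
  then obtain ys where ys: "y = Proper (Finite ys)" "longest_state_suffix ys u"
    using steps_invariant[OF assms(1) False] assms(2) by blast
  then have "last ys = last u" by (auto simp: longest_state_suffix_def suffix_def)
  then show ?thesis using ys False by (simp add: string_mia_def end_point_def)
qed


section \<open>Words over the automaton as pointed strings\<close>

lemma right_word_iff:
  "right_word M v w \<longleftrightarrow> v \<in> trivial_strings Q \<and> left_ended w \<and>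
     (\<forall>u. finite_prefix u w \<longrightarrow> admissible u \<and> (u \<noteq> [] \<longrightarrow> v = start_point u))"
  using steps_defined_iff[of v] by (auto simp: right_word_def left_ended_def string_mia_def)

lemma left_word_iff:
  "left_word M w v \<longleftrightarrow> v \<in> trivial_strings Q \<and> right_ended w \<and>
     (\<forall>u. finite_suffix u w \<longrightarrow> admissible u \<and> (u \<noteq> [] \<longrightarrow> v = end_point u))"
proof -
  have "left_word M w v \<longleftrightarrow> v \<in> trivial_strings Q \<and> right_ended w \<and>
     (\<forall>u. finite_suffix (list_inv u) w \<longrightarrow>
        admissible u \<and> (u \<noteq> [] \<longrightarrow> string_inv v = start_point u))"
    by (auto simp: left_word_def right_word_iff left_ended_word_inv finite_prefix_word_inv
        string_inv_trivial) (auto simp: string_mia_def string_inv_trivial)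
  also have "\<dots> \<longleftrightarrow> v \<in> trivial_strings Q \<and> right_ended w \<and>
     (\<forall>u. finite_suffix u w \<longrightarrow>
        admissible u \<and> (u \<noteq> [] \<longrightarrow> string_inv v = string_inv (end_point u)))"
    by (metis admissible_list_inv list_inv_eq_Nil list_inv_inv string_inv_start_point)
  also have "\<dots> \<longleftrightarrow> v \<in> trivial_strings Q \<and> right_ended w \<and>
     (\<forall>u. finite_suffix u w \<longrightarrow> admissible u \<and> (u \<noteq> [] \<longrightarrow> v = end_point u))"
    by (auto simp: trivial_strings_def end_point_def)
  finally show ?thesis .
qed

text \<open>
  Since steps are defined exactly on strings, the condition that \<open>l\<close> extended by a finite prefix
  of \<open>r\<close> is again a left word becomes the condition on factors across the cut.
\<close>

lemma mia_words_iff: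
  "(l, v, r) \<in> mia_words M \<longleftrightarrow>
     v \<in> trivial_strings Q \<and> right_ended l \<and> left_ended r \<and>
     (\<forall>a b. finite_suffix a l \<longrightarrow> finite_prefix b r \<longrightarrow> admissible (a @ b)) \<and>
     (\<forall>a. finite_suffix a l \<longrightarrow> a \<noteq> [] \<longrightarrow> v = end_point a) \<and>
     (\<forall>b. finite_prefix b r \<longrightarrow> b \<noteq> [] \<longrightarrow> v = start_point b)" (is "?lhs \<longleftrightarrow> ?rhs")
proof
  assume ?lhs
  then have l: "left_word M l v" and r: "right_word M v r"
    and lr: "\<And>u. finite_prefix u r \<Longrightarrow>
      left_word M (word_append l (Finite u)) (entry M (the (steps M v u)))"
    by (auto simp: mia_words_def)
  have "admissible (a @ b)" if "finite_suffix a l" "finite_prefix b r" for a b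
    using lr[OF that(2)] that(1) l by (auto simp: left_word_iff finite_suffix_append)
  then show ?rhs using l r by (auto simp: left_word_iff right_word_iff)
next
  assume rhs: ?rhs
  then have Nil: "finite_suffix [] l" "finite_prefix [] r"
    by (auto intro: finite_prefix_Nil finite_suffix_Nil)
  have ab: "admissible (a @ b)" if "finite_suffix a l" "finite_prefix b r" for a b
    using rhs that by blast
  have l: "left_word M l v"
    using rhs ab[OF _ Nil(2)] by (auto simp: left_word_iff)
  have r: "right_word M v r"
    using rhs ab[OF Nil(1)] by (auto simp: right_word_iff)
  have "left_word M (word_append l (Finite u)) (entry M (the (steps M v u)))"
    if u: "finite_prefix u r" for u
  proof -
    have adm: "admissible u" using ab[OF Nil(1) u] by simp
    then obtain y where y: "steps M v u = Some y"
      using steps_defined_iff[of v u] rhs u by blast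
    define e where "e = entry M (the (steps M v u))"
    have e: "e = (if u = [] then v else end_point u)"
      using entry_steps[OF _ y] rhs y by (simp add: e_def)
    have "e \<in> trivial_strings Q"
      using e rhs end_point_trivial[OF adm] by auto
    moreover have "admissible d \<and> (d \<noteq> [] \<longrightarrow> e = end_point d)"
      if d: "finite_suffix d (word_append l (Finite u))" for d
    proof -
      have "suffix d u \<or> (\<exists>a. d = a @ u \<and> finite_suffix a l)"
        using d finite_suffix_append rhs by blast
      then show ?thesis
      proof (elim disjE exE conjE)
        assume d: "suffix d u"
        then have "admissible d" using admissible_sublist[OF adm] by (simp add: suffix_imp_sublist)
        moreover have "last d = last u" if "d \<noteq> []" using d that by (auto simp: suffix_def)
        ultimately show ?thesis using d by (auto simp: e end_point_def)
      next
        fix a assume a: "d = a @ u" "finite_suffix a l"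
        then show ?thesis using ab[OF a(2) u] rhs by (auto simp: e end_point_def)
      qed
    qed
    ultimately show ?thesis
      using right_ended_append rhs unfolding left_word_iff e_def by blast
  qed
  then show ?lhs using l r rhs by (auto simp: mia_words_def string_mia_def)
qed


section \<open>The bijection\<close>

lemma mia_shift_same_string:
  assumes "(x, y) \<in> mia_shift M"
  shows "word_to_string x = word_to_string y"
proof -
  obtain l1 v1 r1 l2 v2 r2 u where xy: "x = (l1, v1, r1)" "y = (l2, v2, r2)"
    and w: "(l1, v1, r1) \<in> mia_words M" "(l2, v2, r2) \<in> mia_words M"
    and u: "l1 = word_append l2 (Finite u)" "r2 = word_append (Finite u) r1"
      "map_option (entry M) (steps M v2 u) = Some v1"
    using assms by (auto simp: mia_shift_def)
  have ends: "right_ended l2" "left_ended r1" and v2: "v2 \<in> trivial_strings Q"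
    using w by (auto simp: mia_words_iff)
  have "word_append l1 r1 = word_append l2 r2"
    unfolding u by (rule word_append_assoc_Finite[OF ends])
  moreover have "(l1 = Finite [] \<and> r1 = Finite []) \<longleftrightarrow> (l2 = Finite [] \<and> r2 = Finite [])"
    unfolding u using ends by (auto simp: right_ended_def left_ended_def)
  moreover have "v1 = v2" if "l1 = Finite []"
  proof -
    have "u = []" using that ends by (auto simp: u(1) right_ended_def)
    then show ?thesis using u(3) entry_steps[OF v2, of "[]"] by auto
  qed
  ultimately show ?thesis by (auto simp: xy)
qed

text \<open>
  The condition on states in the definition of the shift follows from the letters: the zero-length string
  at the first cut is determined by the last letter of \<open>u\<close> or, if the cuts coincide, by a letter
  next to them.  Two words without letters are told apart by their zero-length strings alone.
\<close>

lemma mia_shiftI: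
  assumes w: "(l1, v1, r1) \<in> mia_words M" "(l2, v2, r2) \<in> mia_words M"
    and u: "l1 = word_append l2 (Finite u)" "r2 = word_append (Finite u) r1"
    and trivial: "l1 = Finite [] \<and> r1 = Finite [] \<Longrightarrow> v1 = v2"
  shows "((l1, v1, r1), (l2, v2, r2)) \<in> mia_shift M"
proof -
  have ends: "right_ended l1" "right_ended l2" "left_ended r1" "left_ended r2"
    and v2: "v2 \<in> trivial_strings Q"
    using w by (auto simp: mia_words_iff)
  have u_pre: "finite_prefix u r2"
  proof (cases r1)
    case (RightInf s)
    have "u = stake (length u) (u @- s)" by (simp add: stake_shift)
    then show ?thesis unfolding u(2) RightInf by auto
  qed (use ends(3) in \<open>auto simp: u(2) left_ended_def\<close>)
  have "right_word M v2 r2" using w(2) by (auto simp: mia_words_def)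
  then obtain y where y: "steps M v2 u = Some y"
    using u_pre by (auto simp: right_word_def)
  have "v1 = (if u = [] then v2 else end_point u)"
  proof (cases "u = []")
    case False
    have "finite_suffix u l1"
      using finite_suffix_append[OF ends(2)] by (simp add: u(1))
    then show ?thesis using w(1) False by (auto simp: mia_words_iff)
  next
    case True
    have same: "l1 = l2" "r1 = r2"
      using True u ends by (auto simp: right_ended_def left_ended_def)
    consider "l1 = Finite []" "r1 = Finite []" | "l1 \<noteq> Finite []" | "r1 \<noteq> Finite []" by blast
    then have "v1 = v2"
    proof cases
      case 1
      then show ?thesis using trivial by blast
    next
      case 2
      then obtain c where "finite_suffix [c] l1" using last_letter ends(1) by metis
      then have "v1 = end_point [c]" "v2 = end_point [c]"
        using w same by (auto simp: mia_words_iff)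
      then show ?thesis by simp
    next
      case 3
      then obtain c where "finite_prefix [c] r1" using first_letter ends(3) by metis
      then have "v1 = start_point [c]" "v2 = start_point [c]"
        using w same by (auto simp: mia_words_iff)
      then show ?thesis by simp
    qed
    then show ?thesis using True by simp
  qed
  then have "map_option (entry M) (steps M v2 u) = Some v1"
    using entry_steps[OF v2 y] y by simp
  then show ?thesis using w u by (auto simp: mia_shift_def)
qed

lemma mia_sim_eq_kernel:
  "mia_sim M = {(x, y). x \<in> mia_words M \<and> y \<in> mia_words M \<and> word_to_string x = word_to_string y}"
proof (intro subset_antisym subrelI)
  fix x y assume xy: "(x, y) \<in> mia_sim M"
  then have "x \<in> mia_words M" "y \<in> mia_words M"
    by (auto simp: mia_sim_def mia_shift_def)
  then show "(x, y) \<in> {(x, y). x \<in> mia_words M \<and> y \<in> mia_words M \<and> word_to_string x = word_to_string y}"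
    using xy mia_shift_same_string[of x y] mia_shift_same_string[of y x] by (auto simp: mia_sim_def)
next
  fix x y
  assume "(x, y) \<in> {(x, y). x \<in> mia_words M \<and> y \<in> mia_words M \<and> word_to_string x = word_to_string y}"
  then have w: "x \<in> mia_words M" "y \<in> mia_words M" and eq: "word_to_string x = word_to_string y"
    by auto
  obtain l1 v1 r1 l2 v2 r2 where xy: "x = (l1, v1, r1)" "y = (l2, v2, r2)"
    by (cases x; cases y) auto
  have ends: "right_ended l1" "left_ended r1" "right_ended l2" "left_ended r2"
    and v: "v1 \<in> trivial_strings Q" "v2 \<in> trivial_strings Q"
    using w by (auto simp: xy mia_words_iff)
  have proper: "v1 \<noteq> Proper z" "v2 \<noteq> Proper z" for z
    using v by (auto simp: trivial_strings_def)
  have app: "word_append l1 r1 = word_append l2 r2"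
    using eq proper proper[symmetric] by (auto simp: xy split: if_splits)
  have trivial: "v1 = v2"
    if "(l1 = Finite [] \<and> r1 = Finite []) \<or> (l2 = Finite [] \<and> r2 = Finite [])"
    using eq that proper proper[symmetric] by (auto simp: xy split: if_splits)
  obtain u where "(l1 = word_append l2 (Finite u) \<and> r2 = word_append (Finite u) r1) \<or>
      (l2 = word_append l1 (Finite u) \<and> r1 = word_append (Finite u) r2)"
    using word_append_eq_cases[OF ends app] by blast
  then have "(x, y) \<in> mia_shift M \<or> (y, x) \<in> mia_shift M"
  proof
    assume "l1 = word_append l2 (Finite u) \<and> r2 = word_append (Finite u) r1"
    then have "(x, y) \<in> mia_shift M"
      unfolding xy using w trivial by (intro mia_shiftI) (auto simp: xy)
    then show ?thesis ..
  next
    assume "l2 = word_append l1 (Finite u) \<and> r1 = word_append (Finite u) r2"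
    then have "(y, x) \<in> mia_shift M"
      unfolding xy using w trivial by (intro mia_shiftI) (auto simp: xy)
    then show ?thesis ..
  qed
  then show "(x, y) \<in> mia_sim M" by (auto simp: mia_sim_def)
qed

lemma Proper_in_strings_iff:
  assumes "right_ended l" "left_ended r" "l \<noteq> Finite [] \<or> r \<noteq> Finite []"
  shows "Proper (word_append l r) \<in> strings Q \<rho> \<longleftrightarrow>
    (\<forall>u \<in> finite_factors (word_append l r). admissible u)"
proof (cases "\<exists>xs ys. l = Finite xs \<and> r = Finite ys")
  case True
  then obtain xs ys where lr: "l = Finite xs" "r = Finite ys" by blast
  have "Proper (word_append l r) \<in> strings Q \<rho> \<longleftrightarrow> admissible (xs @ ys)"
    using assms(3) by (auto simp: lr strings_def trivial_strings_def is_infinite_string_def admissible_def)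
  also have "\<dots> \<longleftrightarrow> (\<forall>u \<in> finite_factors (word_append l r). admissible u)"
    using admissible_sublist by (auto simp: lr)
  finally show ?thesis .
next
  case False
  then show ?thesis
    using assms(1,2) by (auto simp: left_ended_def right_ended_def strings_def trivial_strings_def
        is_infinite_string_def admissible_def)
qed

lemma word_to_string_in_strings:
  assumes "x \<in> mia_words M"
  shows "word_to_string x \<in> strings Q \<rho>"
proof -
  obtain l v r where x: "x = (l, v, r)" by (cases x)
  have ends: "right_ended l" "left_ended r" and v: "v \<in> trivial_strings Q"
    and ab: "\<And>a b. finite_suffix a l \<Longrightarrow> finite_prefix b r \<Longrightarrow> admissible (a @ b)"
    using assms by (auto simp: x mia_words_iff)
  show ?thesis
  proof (cases "l = Finite [] \<and> r = Finite []")
    case True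
    then show ?thesis using v by (simp add: x strings_def)
  next
    case False
    have "admissible u" if "u \<in> finite_factors (word_append l r)" for u
      using finite_factors_append[OF ends that] ab admissible_sublist by metis
    then show ?thesis using Proper_in_strings_iff[OF ends] False by (auto simp: x)
  qed
qed

text \<open>
  Every cut of a string carries a zero-length string: the one determined by the letter after the
  cut, or, at the right end, by the letter before it.
\<close>

lemma pointed_word_of_string:
  assumes ends: "right_ended l" "left_ended r" and ne: "l \<noteq> Finite [] \<or> r \<noteq> Finite []"
    and s: "Proper (word_append l r) \<in> strings Q \<rho>"
  shows "Proper (word_append l r) \<in> word_to_string ` mia_words M"
proof -
  have ab: "admissible (a @ b)" if "finite_suffix a l" "finite_prefix b r" for a b
    using append_in_finite_factors[OF that] s Proper_in_strings_iff[OF ends ne] by blast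
  have l: "admissible a" if "finite_suffix a l" for a
    using ab[OF that finite_prefix_Nil[OF ends(2)]] by simp
  have r: "admissible b" if "finite_prefix b r" for b
    using ab[OF finite_suffix_Nil[OF ends(1)] that] by simp
  have "\<exists>v \<in> trivial_strings Q. (\<forall>a. finite_suffix a l \<longrightarrow> a \<noteq> [] \<longrightarrow> v = end_point a) \<and>
     (\<forall>b. finite_prefix b r \<longrightarrow> b \<noteq> [] \<longrightarrow> v = start_point b)"
  proof (cases "r = Finite []")
    case True
    then have "l \<noteq> Finite []" using ne by simp
    with ends(1) obtain c where c: "finite_suffix [c] l"
      "\<And>a. \<lbrakk>finite_suffix a l; a \<noteq> []\<rbrakk> \<Longrightarrow> last a = c"
      using last_letter by metis
    show ?thesis
      using True c end_point_trivial[OF l[OF c(1)]]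
      by (intro bexI[of _ "end_point [c]"]) (auto simp: end_point_def)
  next
    case False
    with ends(2) obtain c where c: "finite_prefix [c] r"
      "\<And>b. \<lbrakk>finite_prefix b r; b \<noteq> []\<rbrakk> \<Longrightarrow> hd b = c"
      using first_letter by metis
    have "start_point [c] = end_point a" if "finite_suffix a l" "a \<noteq> []" for a
      using end_point_eq_start_point[OF ab[OF that(1) c(1)] that(2)] by simp
    then show ?thesis
      using c(2) start_point_trivial[OF r[OF c(1)]]
      by (intro bexI[of _ "start_point [c]"]) (auto simp: start_point_def)
  qed
  then obtain v where "(l, v, r) \<in> mia_words M"
    using ends ab unfolding mia_words_iff by blast
  moreover have "word_to_string (l, v, r) = Proper (word_append l r)"
    using ne by auto
  ultimately show ?thesis by (metis imageI)
qed

lemma trivial_word: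
  assumes "v \<in> trivial_strings Q"
  shows "(Finite [], v, Finite []) \<in> mia_words M"
  using assms by (auto simp: mia_words_iff right_ended_def left_ended_def)

lemma word_to_string_image: "word_to_string ` mia_words M = strings Q \<rho>"
proof (intro subset_antisym subsetI)
  fix z assume "z \<in> word_to_string ` mia_words M"
  then show "z \<in> strings Q \<rho>" using word_to_string_in_strings by blast
next
  fix z assume z: "z \<in> strings Q \<rho>"
  show "z \<in> word_to_string ` mia_words M"
  proof (cases "z \<in> trivial_strings Q")
    case True
    from imageI[OF trivial_word[OF this], of word_to_string] show ?thesis by simp
  next
    case False
    obtain w where w: "z = Proper w" "w \<noteq> Finite []" "(\<exists>xs. w = Finite xs) \<or>
        (\<exists>s. w = RightInf s) \<or> (\<exists>s. w = LeftInf s) \<or> (\<exists>f. w = BiInf (shift_class f))"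
      using z False by (auto simp: strings_def is_infinite_string_def is_string_list_def)
    obtain l r where "w = word_append l r" "right_ended l" "left_ended r"
      "l \<noteq> Finite [] \<or> r \<noteq> Finite []"
    proof -
      from w(3) consider (fin) xs where "w = Finite xs" | (right) s where "w = RightInf s"
        | (left) s where "w = LeftInf s" | (both) f where "w = BiInf (shift_class f)" by blast
      then show thesis
      proof cases
        case (fin xs)
        then show thesis using w(2)
          by (intro that[of "Finite []" w]) (auto simp: right_ended_def left_ended_def)
      next
        case (right s)
        then show thesis
          by (intro that[of "Finite []" w]) (auto simp: right_ended_def left_ended_def)
      next
        case (left s)
        then show thesis
          by (intro that[of w "Finite []"]) (auto simp: right_ended_def left_ended_def)
      next
        case (both f)
        \<comment> \<open>Cut just before position 0; the left part is listed from the cut outwards.\<close>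
        define s where "s = smap (\<lambda>n. f (- int n - 1)) nats"
        define t where "t = smap (\<lambda>n. f (int n)) nats"
        have "bi_join s t = f"
          by (rule ext) (simp add: bi_join_def s_def t_def)
        then show thesis using both
          by (intro that[of "LeftInf s" "RightInf t"]) (auto simp: right_ended_def left_ended_def)
      qed
    qed
    then show ?thesis using pointed_word_of_string z w(1) by blast
  qed
qed

end

theorem theorem5p6:
  fixes K :: "'k ring" and Q :: "('v, 'a) pre_digraph" and \<rho> :: "'a list set"
    and \<sigma> \<epsilon> :: "'a \<Rightarrow> int"
  defines "M \<equiv> string_mia Q \<rho> \<sigma> \<epsilon>"
  assumes "string_algebra K Q \<rho>"
    and "sign_maps Q \<rho> \<sigma> \<epsilon>"
  shows "equiv (mia_words M) (mia_sim M) \<and>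
    word_to_string respects mia_sim M \<and>
    bij_betw (\<lambda>C. the_elem (word_to_string ` C)) (mia_words M // mia_sim M) (strings Q \<rho>)"
proof -
  interpret signed_string_algebra K Q \<rho> \<sigma> \<epsilon>
    using assms(2,3) by (rule signed_string_algebra.intro)
  show ?thesis
    unfolding M_def word_to_string_image[symmetric]
    using kernel_quotient[OF mia_sim_eq_kernel] by blast
qed

end
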